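(* Let $d \ge 1$, $\sigma_d > 0$, and $x, y \in \mathbb{R}^d$ with $x \neq y$. Let $(x',y')$ be the random pair in $\mathbb{R}^d\times\mathbb{R}^d$ output by the sampling procedure $\mathsf{MaxIndep}_d(x,y,\sigma_d)$ described in the context. Then $(x',y')$ is distributed according to the maximal independent coupling of $\mathrm{N}(x, I_d\sigma_d^2)$ and $\mathrm{N}(y, I_d\sigma_d^2)$.
   Context: Couplings. For probability measures $\mu,\nu$ on $\mathbb{R}^d$ (Borel $\sigma$-algebra $\mathcal{B}$), a coupling of $\mu$ and $\nu$ is a probability measure on $\mathbb{R}^d\times\mathbb{R}^d$ with marginals $\mu$ and $\nu$. A coupling is maximal if $(x',y')$ drawn from it satisfies $\mathbb{P}(x'=y') = 1 - \sup_{A\in\mathcal{B}}|\mu(A)-\nu(A)|$. The maximal independent coupling of $\mu$ and $\nu$ (for $\mu\neq\nu$) is the unique maximal coupling of $\mu$ and $\nu$ under which $x'$ and $y'$ are independent conditionally on the event $\{x'\neq y'\}$. Notation. $\mathrm{N}(\mu,\Sigma)$ is the multivariate normal law and $\mathrm{N}(z;\mu,\Sigma)$ its density at $z$; $\mathrm{Unif}$ is the uniform distribution on $[0,1]$; $^{\top}$ denotes transpose. Basic rejection procedure in one dimension, for real numbers $x_1\neq y_1$ and $\sigma_d>0$: 1. Draw $x_1'\sim \mathrm{N}(x_1,\sigma_d^2)$ and, independently, $W_x\sim\mathrm{Unif}$. 2. If $W_x\,\mathrm{N}(x_1';x_1,\sigma_d^2)\le \mathrm{N}(x_1';y_1,\sigma_d^2)$,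 set $y_1'=x_1'$. 3. Otherwise, repeatedly draw fresh independent $\tilde y_1\sim \mathrm{N}(y_1,\sigma_d^2)$ and $W_y\sim \mathrm{Unif}$ until $W_y\,\mathrm{N}(\tilde y_1;y_1,\sigma_d^2) > \mathrm{N}(\tilde y_1;x_1,\sigma_d^2)$, and set $y_1'=\tilde y_1$ for the first such draw. 4. Return $(x_1',y_1')$. It is known that the output of this procedure follows the maximal independent coupling of $\mathrm{N}(x_1,\sigma_d^2)$ and $\mathrm{N}(y_1,\sigma_d^2)$. Procedure $\mathsf{MaxIndep}_d(x,y,\sigma_d)$ (all draws in different steps are mutually independent): 1. Compute $e=(y-x)/\lVert y-x\rVert$, $x_1=e^{\top}x$, $y_1=e^{\top}y$. 2. Draw $(x_1',y_1')$ from the maximal independent coupling of $\mathrm{N}(x_1,\sigma_d^2)$ and $\mathrm{N}(y_1,\sigma_d^2)$ using the basic rejection procedure. 3. Independently draw $\tilde x\sim\mathrm{N}(x,I_d\sigma_d^2)$ and $\tilde y\sim \mathrm{N}(y,I_d\sigma_d^2)$. 4. Set $x'_{-1}=(I_d-ee^{\top})\tilde x$ and $y'_{-1}=(I_d-ee^{\top})\tilde y$. 5. Set $x'=x_1'e+x'_{-1}$. If $x_1'=y_1'$, set $y'=y_1'e+x'_{-1}$; otherwise set $y'=y_1'e+y'_{-1}$. 6. Return $(x',y')$. *)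

theory Defs
  imports "HOL-Probability.Probability"
begin

section \<open>Couplings\<close>

definition total_variation :: "'a::topological_space measure \<Rightarrow> 'a measure \<Rightarrow> real" where
  "total_variation \<mu> \<nu> = (SUP A\<in>sets borel. \<bar>measure \<mu> A - measure \<nu> A\<bar>)"

definition coupling ::
  "'a::topological_space measure \<Rightarrow> 'a measure \<Rightarrow> ('a \<times> 'a) measure \<Rightarrow> bool" where
  "coupling \<mu> \<nu> \<gamma> \<longleftrightarrow>
     prob_space \<gamma> \<and> sets \<gamma> = sets (borel \<Otimes>\<^sub>M borel) \<and>
     distr \<gamma> borel fst = \<mu> \<and> distr \<gamma> borel snd = \<nu>"

definition maximal_coupling ::
  "'a::topological_space measure \<Rightarrow> 'a measure \<Rightarrow> ('a \<times> 'a) measure \<Rightarrow> bool" where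
  "maximal_coupling \<mu> \<nu> \<gamma> \<longleftrightarrow>
     coupling \<mu> \<nu> \<gamma> \<and>
     measure \<gamma> {p \<in> space \<gamma>. fst p = snd p} = 1 - total_variation \<mu> \<nu>"

text \<open>
  For \<open>\<mu> \<noteq> \<nu>\<close>, a maximal coupling gives positive probability to the event that the two
  components differ, so that \<open>uniform_measure \<gamma> {p \<in> space \<gamma>. fst p \<noteq> snd p}\<close> is \<open>\<gamma>\<close>
  conditioned on that event.
\<close>

definition conditionally_independent_off_diagonal ::
  "('a::topological_space \<times> 'a) measure \<Rightarrow> bool" where
  "conditionally_independent_off_diagonal \<gamma> \<longleftrightarrow>
     prob_space.indep_var (uniform_measure \<gamma> {p \<in> space \<gamma>. fst p \<noteq> snd p}) borel fst borel snd"

text \<open>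
  \<open>\<gamma>\<close> is \<^emph>\<open>the\<close> maximal independent coupling of \<open>\<mu>\<close> and \<open>\<nu>\<close>. The definite article is taken
  literally: uniqueness is part of the definition.
\<close>

definition is_maximal_independent_coupling ::
  "'a::topological_space measure \<Rightarrow> 'a measure \<Rightarrow> ('a \<times> 'a) measure \<Rightarrow> bool" where
  "is_maximal_independent_coupling \<mu> \<nu> \<gamma> \<longleftrightarrow>
     maximal_coupling \<mu> \<nu> \<gamma> \<and> conditionally_independent_off_diagonal \<gamma> \<and>
     (\<forall>\<gamma>'. maximal_coupling \<mu> \<nu> \<gamma>' \<and> conditionally_independent_off_diagonal \<gamma>' \<longrightarrow> \<gamma>' = \<gamma>)"


section \<open>Multivariate normal law\<close>

definition mvn_density :: "real^'n \<Rightarrow> real^'n^'n \<Rightarrow> real^'n::finite \<Rightarrow> real" where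
  "mvn_density m S z =
     exp (- ((z - m) \<bullet> (matrix_inv S *v (z - m))) / 2) / sqrt ((2 * pi) ^ CARD('n) * det S)"

definition mvn :: "real^'n \<Rightarrow> real^'n^'n \<Rightarrow> (real^'n::finite) measure" where
  "mvn m S = density lborel (\<lambda>z. ennreal (mvn_density m S z))"


section \<open>Basic rejection procedure\<close>

definition normal_law :: "real \<Rightarrow> real \<Rightarrow> real measure" where
  "normal_law m s = density lborel (\<lambda>z. ennreal (normal_density m s z))"

definition unif01 :: "real measure" where
  "unif01 = uniform_measure lborel {0..1}"

text \<open>
  The independent draws consumed by the procedure: \<open>((x\<^sub>1', W\<^sub>x), \<omega>)\<close>, where \<open>\<omega> k\<close> is the pair
  of the proposal and of the uniform variable used in the \<open>k\<close>-th round of the rejection loop.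
\<close>

definition rejection_draws ::
  "real \<Rightarrow> real \<Rightarrow> real \<Rightarrow> ((real \<times> real) \<times> (nat \<Rightarrow> real \<times> real)) measure" where
  "rejection_draws x1 y1 s =
     (normal_law x1 s \<Otimes>\<^sub>M unif01) \<Otimes>\<^sub>M (\<Pi>\<^sub>M k\<in>UNIV. normal_law y1 s \<Otimes>\<^sub>M unif01)"

definition rejection_accepts :: "real \<Rightarrow> real \<Rightarrow> real \<Rightarrow> real \<times> real \<Rightarrow> bool" where
  "rejection_accepts x1 y1 s = (\<lambda>(yt, w). w * normal_density y1 s yt > normal_density x1 s yt)"

text \<open>
  If no round of the loop accepts, which for \<open>x1 \<noteq> y1\<close> has probability zero, the round
  selected by \<open>LEAST\<close> is unspecified.
\<close>

definition rejection_output ::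
  "real \<Rightarrow> real \<Rightarrow> real \<Rightarrow> (real \<times> real) \<times> (nat \<Rightarrow> real \<times> real) \<Rightarrow> real \<times> real" where
  "rejection_output x1 y1 s = (\<lambda>((x1', w), \<omega>).
     (x1',
      if w * normal_density x1 s x1' \<le> normal_density y1 s x1' then x1'
      else fst (\<omega> (LEAST k. rejection_accepts x1 y1 s (\<omega> k)))))"

definition rejection_law :: "real \<Rightarrow> real \<Rightarrow> real \<Rightarrow> (real \<times> real) measure" where
  "rejection_law x1 y1 s =
     distr (rejection_draws x1 y1 s) (borel \<Otimes>\<^sub>M borel) (rejection_output x1 y1 s)"


section \<open>The procedure in dimension \<open>CARD('n)\<close>\<close>

definition outer :: "real^'n \<Rightarrow> real^'n \<Rightarrow> real^'n^'n::finite" where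
  "outer u v = (\<chi> i j. u $ i * v $ j)"

definition direction :: "real^'n \<Rightarrow> real^'n \<Rightarrow> real^'n::finite" where
  "direction x y = (1 / norm (y - x)) *\<^sub>R (y - x)"

definition max_indep_output ::
  "real^'n \<Rightarrow> (real \<times> real) \<times> ((real^'n) \<times> (real^'n)) \<Rightarrow> (real^'n) \<times> (real^'n::finite)" where
  "max_indep_output e = (\<lambda>((x1', y1'), (xt, yt)).
     let P = mat 1 - outer e e;
         xp = P *v xt;
         yp = P *v yt
     in (x1' *\<^sub>R e + xp,
         if x1' = y1' then y1' *\<^sub>R e + xp else y1' *\<^sub>R e + yp))"

text \<open>The law of the output of the procedure; the draws of different steps are independent.\<close>

definition max_indep_law ::
  "real^'n \<Rightarrow> real^'n \<Rightarrow> real \<Rightarrow> ((real^'n) \<times> (real^'n::finite)) measure" where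
  "max_indep_law x y s =
     (let e = direction x y in
        distr
          (rejection_law (e \<bullet> x) (e \<bullet> y) s \<Otimes>\<^sub>M
            (mvn x (s\<^sup>2 *\<^sub>R mat 1) \<Otimes>\<^sub>M mvn y (s\<^sup>2 *\<^sub>R mat 1)))
          (borel \<Otimes>\<^sub>M borel)
          (max_indep_output e))"

end

theory Submission
  imports Defs
begin

text \<open>
  If \<open>\<mu>\<close> and \<open>\<nu>\<close> have densities \<open>f\<close> and \<open>g\<close>, a maximal coupling must carry \<open>min f g\<close> on the diagonal,
  so its off-diagonal part has marginals \<open>(f - g)\<^sup>+\<close> and \<open>(g - f)\<^sup>+\<close>; conditional independence then
  forces it to be their normalised product. It remains to bring the law of the procedure into this
  form. In one dimension this is rejection sampling. Orthogonally to \<open>e\<close> the two normal laws agree,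
  so that \<open>f (z) / f\<^sub>1 (e \<bullet> z) = g (z) / g\<^sub>1 (e \<bullet> z)\<close> and attaching the orthogonal components turns
  \<open>min f\<^sub>1 g\<^sub>1\<close>, \<open>(f\<^sub>1 - g\<^sub>1)\<^sup>+\<close>, \<open>(g\<^sub>1 - f\<^sub>1)\<^sup>+\<close> into \<open>min f g\<close>, \<open>(f - g)\<^sup>+\<close>, \<open>(g - f)\<^sup>+\<close>.
\<close>

section \<open>Maximal couplings of two densities\<close>

text \<open>The preimages of Borel sets under \<open>fst\<close> and \<open>snd\<close> are the
  strips \<open>A \<times> UNIV\<close> and \<open>UNIV \<times> B\<close>. Each family of strips is
  already a sigma-algebra, so independence needs testing only on rectangles. Clearing the
  denominators of \<open>uniform_measure\<close>, which \<open>pos\<close> allows, leaves an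
  identity about \<open>\<gamma>\<close> alone.\<close>

lemma conditionally_independent_off_diagonal_iff:
  fixes \<gamma> :: "('a::euclidean_space \<times> 'a) measure"
  assumes "prob_space \<gamma>" and sets_\<gamma>[measurable_cong]: "sets \<gamma> = sets (borel \<Otimes>\<^sub>M borel)"
    and pos: "measure \<gamma> {p. fst p \<noteq> snd p} > 0"
  shows "conditionally_independent_off_diagonal \<gamma> \<longleftrightarrow>
    (\<forall>A\<in>sets borel. \<forall>B\<in>sets borel.
      measure \<gamma> ({p. fst p \<noteq> snd p} \<inter> A \<times> B) * measure \<gamma> {p. fst p \<noteq> snd p} =
      measure \<gamma> ({p. fst p \<noteq> snd p} \<inter> A \<times> UNIV) * measure \<gamma> ({p. fst p \<noteq> snd p} \<inter> UNIV \<times> B))"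
    (is "_ \<longleftrightarrow> ?R")
proof -
  interpret prob_space \<gamma> by fact
  define N where "N = {p::'a \<times> 'a. fst p \<noteq> snd p}"
  have space_\<gamma>: "space \<gamma> = UNIV"
    using sets_eq_imp_space_eq[OF sets_\<gamma>] by (simp add: space_pair_measure)
  have N: "N \<in> sets \<gamma>"
    unfolding N_def sets_\<gamma> borel_prod by (intro borel_open open_Collect_neq) (auto intro: continuous_intros)
  have N0: "measure \<gamma> N > 0" using pos by (simp add: N_def)
  then have e: "emeasure \<gamma> N \<noteq> 0" "emeasure \<gamma> N \<noteq> \<infinity>"
    by (auto simp: emeasure_eq_measure)
  let ?U = "uniform_measure \<gamma> N"
  interpret U: prob_space ?U
    using e by (intro prob_space_uniform_measure) auto
  have um: "measure ?U S = measure \<gamma> (N \<inter> S) / measure \<gamma> N" if "S \<in> sets \<gamma>" for S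
    using measure_uniform_measure[OF e that] .
  have rect: "A \<times> B \<in> sets \<gamma>" if "A \<in> sets borel" "B \<in> sets borel" for A B
    using that by (simp add: sets_\<gamma>)
  have fstV: "fst -` A = A \<times> (UNIV::'a set)" for A :: "'a set" by auto
  have sndV: "snd -` A = (UNIV::'a set) \<times> A" for A :: "'a set" by auto
  have "measurable ?U borel = measurable (borel \<Otimes>\<^sub>M borel) (borel :: 'a measure)"
    by (rule measurable_cong_sets) (simp_all add: sets_\<gamma>)
  then have meas: "fst \<in> measurable ?U borel" "snd \<in> measurable ?U borel"
    by simp_all
  have "conditionally_independent_off_diagonal \<gamma> \<longleftrightarrow> U.indep_var borel fst borel snd"
    by (simp add: conditionally_independent_off_diagonal_def space_\<gamma> N_def)
  also have "\<dots> \<longleftrightarrow> (\<forall>A\<in>sets borel. \<forall>B\<in>sets borel.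
      measure ?U (A \<times> B) = measure ?U (A \<times> UNIV) * measure ?U (UNIV \<times> B))" (is "?L \<longleftrightarrow> ?M")
  proof
    assume ?L
    show ?M
    proof (intro ballI)
      fix A B :: "'a set" assume "A \<in> sets borel" "B \<in> sets borel"
      from U.indep_varD[OF \<open>?L\<close> this]
      show "measure ?U (A \<times> B) = measure ?U (A \<times> UNIV) * measure ?U (UNIV \<times> B)"
        unfolding fstV sndV by (simp add: space_\<gamma>)
    qed
  next
    assume M: ?M
    have sigma_borel: "sigma_sets UNIV (sets borel) = sets (borel :: 'a measure)"
      using sets.sigma_sets_eq[of "borel :: 'a measure"] unfolding space_borel .
    have s1: "sigma_sets UNIV {A \<times> (UNIV::'a set) |A. A \<in> sets (borel :: 'a measure)} = {A \<times> UNIV |A. A \<in> sets (borel :: 'a measure)}"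
      by (rule sigma_sets_vimage_commute[of fst "UNIV :: ('a \<times> 'a) set" UNIV "sets (borel::'a measure)",
            OF Pi_I[OF UNIV_I], unfolded fstV sigma_borel Int_UNIV_right, symmetric])
    have s2: "sigma_sets UNIV {(UNIV::'a set) \<times> A |A. A \<in> sets (borel :: 'a measure)} = {UNIV \<times> A |A. A \<in> sets (borel :: 'a measure)}"
      by (rule sigma_sets_vimage_commute[of snd "UNIV :: ('a \<times> 'a) set" UNIV "sets (borel::'a measure)",
            OF Pi_I[OF UNIV_I], unfolded sndV sigma_borel Int_UNIV_right, symmetric])
    have "measure ?U (A \<times> UNIV \<inter> UNIV \<times> B) = measure ?U (A \<times> UNIV) * measure ?U (UNIV \<times> B)"
      if "A \<in> sets borel" "B \<in> sets borel" for A B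
      using M that by (simp only: Times_Int_Times Int_UNIV_right Int_UNIV_left)
    then have "U.indep_set {A \<times> UNIV |A. A \<in> sets borel} {UNIV \<times> B |B. B \<in> sets borel}"
      unfolding U.indep_sets2_eq
      by (intro conjI ballI subsetI; elim CollectE exE conjE; simp add: rect)
    then show ?L
      unfolding U.indep_var_eq space_uniform_measure space_\<gamma> Int_UNIV_right fstV sndV s1 s2
      by (intro conjI meas)
  qed
  also have "\<dots> \<longleftrightarrow> ?R"
    using N0 by (simp add: um rect N_def[symmetric] field_simps)
  finally show ?thesis .
qed

section \<open>Decomposition of two densities into a common part and two excesses\<close>

locale density_pair =
  fixes f g :: "'a::euclidean_space \<Rightarrow> real"
  assumes f[measurable]: "f \<in> borel_measurable borel" and g[measurable]: "g \<in> borel_measurable borel"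
    and f_nonneg: "\<And>z. 0 \<le> f z" and g_nonneg: "\<And>z. 0 \<le> g z"
    and f_integral: "(\<integral>\<^sup>+z. ennreal (f z) \<partial>lborel) = 1"
    and g_integral: "(\<integral>\<^sup>+z. ennreal (g z) \<partial>lborel) = 1"
    and distinct: "\<not> (AE z in lborel. f z = g z)"
begin

definition \<mu> where "\<mu> = density lborel (\<lambda>z. ennreal (f z))"
definition \<nu> where "\<nu> = density lborel (\<lambda>z. ennreal (g z))"
definition overlap where "overlap = density lborel (\<lambda>z. ennreal (min (f z) (g z)))"
definition left_excess where "left_excess = density lborel (\<lambda>z. ennreal (max 0 (f z - g z)))"
definition right_excess where "right_excess = density lborel (\<lambda>z. ennreal (max 0 (g z - f z)))"
text \<open>This is also the mass of \<open>right_excess\<close>, and by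
  \<open>total_variation_eq\<close> it is the total variation distance of \<open>\<mu>\<close> and
  \<open>\<nu>\<close>.\<close>

definition excess_mass where "excess_mass = measure left_excess UNIV"

lemma sets_parts[measurable_cong, simp]:
  "sets \<mu> = sets borel" "sets \<nu> = sets borel" "sets overlap = sets borel"
  "sets left_excess = sets borel" "sets right_excess = sets borel"
  by (auto simp: \<mu>_def \<nu>_def overlap_def left_excess_def right_excess_def)

lemma space_parts[simp]:
  "space \<mu> = UNIV" "space \<nu> = UNIV" "space overlap = UNIV" "space left_excess = UNIV" "space right_excess = UNIV"
  by (auto simp: \<mu>_def \<nu>_def overlap_def left_excess_def right_excess_def)

lemma emeasure_parts:
  assumes [measurable]: "A \<in> sets borel"
  shows "emeasure \<mu> A = emeasure overlap A + emeasure left_excess A" "emeasure \<nu> A = emeasure overlap A + emeasure right_excess A"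
proof -
  have "ennreal (f z) = ennreal (min (f z) (g z)) + ennreal (max 0 (f z - g z))"
    "ennreal (g z) = ennreal (min (f z) (g z)) + ennreal (max 0 (g z - f z))" for z
    using f_nonneg[of z] g_nonneg[of z]
    by (cases "f z \<le> g z"; simp add: min_def max_def ennreal_neg ennreal_plus[symmetric] del: ennreal_plus)+
  then show "emeasure \<mu> A = emeasure overlap A + emeasure left_excess A" "emeasure \<nu> A = emeasure overlap A + emeasure right_excess A"
    unfolding \<mu>_def \<nu>_def overlap_def left_excess_def right_excess_def
    by (simp_all add: emeasure_density distrib_right nn_integral_add)
qed

sublocale \<mu>: prob_space \<mu>
  by standard (simp add: \<mu>_def emeasure_density f_integral)

sublocale \<nu>: prob_space \<nu>
  by standard (simp add: \<nu>_def emeasure_density g_integral)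

lemma emeasure_UNIV_parts: "emeasure overlap UNIV + emeasure left_excess UNIV = 1" "emeasure overlap UNIV + emeasure right_excess UNIV = 1"
  using emeasure_parts[of UNIV] \<mu>.emeasure_space_1 \<nu>.emeasure_space_1 by auto

sublocale overlap: finite_measure overlap
  using emeasure_UNIV_parts by (intro finite_measureI) auto

sublocale left_excess: finite_measure left_excess
  using emeasure_UNIV_parts by (intro finite_measureI) auto

sublocale right_excess: finite_measure right_excess
  using emeasure_UNIV_parts by (intro finite_measureI) auto

lemma measure_parts:
  assumes "A \<in> sets borel"
  shows "measure \<mu> A = measure overlap A + measure left_excess A" "measure \<nu> A = measure overlap A + measure right_excess A"
  using emeasure_parts[OF assms]
  by (auto simp: \<mu>.emeasure_eq_measure \<nu>.emeasure_eq_measure overlap.emeasure_eq_measure left_excess.emeasure_eq_measure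
      right_excess.emeasure_eq_measure ennreal_plus[symmetric] simp del: ennreal_plus)

lemma measure_UNIV_parts: "measure overlap UNIV = 1 - excess_mass" "measure right_excess UNIV = excess_mass"
  using measure_parts[of UNIV] \<mu>.prob_space \<nu>.prob_space by (auto simp: excess_mass_def)

text \<open>The set \<open>{z. g z < f z}\<close> is a Hahn set for the signed measure
  \<open>\<mu> - \<nu>\<close>: the density of \<open>right_excess\<close> vanishes on it, that of
  \<open>left_excess\<close> off it.\<close>

lemma measure_excess_null:
  "measure right_excess (A \<inter> {z. g z < f z}) = 0" "measure left_excess (A - {z. g z < f z}) = 0"
proof -
  have "emeasure right_excess {z. g z < f z} = 0" "emeasure left_excess (- {z. g z < f z}) = 0"
    by (auto simp: left_excess_def right_excess_def emeasure_density nn_integral_0_iff_AE indicator_def max_def)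
  then have "measure right_excess {z. g z < f z} = 0" "measure left_excess (- {z. g z < f z}) = 0"
    by (simp_all add: measure_def)
  with right_excess.finite_measure_mono[of "A \<inter> {z. g z < f z}" "{z. g z < f z}"]
    left_excess.finite_measure_mono[of "A - {z. g z < f z}" "- {z. g z < f z}"]
  show "measure right_excess (A \<inter> {z. g z < f z}) = 0" "measure left_excess (A - {z. g z < f z}) = 0"
    using measure_nonneg[of right_excess] measure_nonneg[of left_excess] by (auto intro!: antisym)
qed

text \<open>Both excesses have the same mass. If it were zero, both positive parts would vanish
  almost everywhere, contradicting \<open>distinct\<close>. All later divisions by
  \<open>excess_mass\<close> rest on this.\<close>

lemma excess_mass_pos: "excess_mass > 0"
proof -
  have "excess_mass \<noteq> 0"
  proof
    assume "excess_mass = 0"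
    then have "emeasure left_excess UNIV = 0" "emeasure right_excess UNIV = 0"
      using measure_UNIV_parts by (auto simp: excess_mass_def left_excess.emeasure_eq_measure right_excess.emeasure_eq_measure)
    then have "AE z in lborel. ennreal (max 0 (f z - g z)) = 0" "AE z in lborel. ennreal (max 0 (g z - f z)) = 0"
      by (auto simp: left_excess_def right_excess_def emeasure_density nn_integral_0_iff_AE)
    then have "AE z in lborel. f z = g z"
      by eventually_elim (auto simp: ennreal_eq_0_iff max_def split: if_splits)
    with distinct show False ..
  qed
  then show ?thesis
    unfolding excess_mass_def by (simp add: zero_less_measure_iff)
qed

text \<open>The common part cancels in \<open>measure \<mu> A - measure \<nu> A\<close>, which
  leaves a difference of two numbers between \<open>0\<close> and \<open>excess_mass\<close>. The
  Hahn set \<open>{z. g z < f z}\<close> attains the bound.\<close>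

lemma total_variation_eq: "total_variation \<mu> \<nu> = excess_mass"
  unfolding total_variation_def
proof (rule cSup_eq_maximum)
  have "measure left_excess (UNIV - {z. g z < f z}) = 0" "measure right_excess (UNIV \<inter> {z. g z < f z}) = 0"
    by (rule measure_excess_null)+
  moreover have "measure left_excess (UNIV - {z. g z < f z}) = excess_mass - measure left_excess {z. g z < f z}"
    using left_excess.finite_measure_compl[of "{z. g z < f z}"] by (simp add: excess_mass_def)
  ultimately have "excess_mass = \<bar>measure \<mu> {z. g z < f z} - measure \<nu> {z. g z < f z}\<bar>"
    using excess_mass_pos by (simp add: measure_parts)
  then show "excess_mass \<in> (\<lambda>A. \<bar>measure \<mu> A - measure \<nu> A\<bar>) ` sets borel"
    by (intro image_eqI) auto
next
  fix r assume "r \<in> (\<lambda>A. \<bar>measure \<mu> A - measure \<nu> A\<bar>) ` sets borel"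
  then obtain A where A: "A \<in> sets borel" "r = \<bar>measure \<mu> A - measure \<nu> A\<bar>" by auto
  have "measure left_excess A \<le> excess_mass" "measure right_excess A \<le> excess_mass"
    using left_excess.bounded_measure[of A] right_excess.bounded_measure[of A] measure_UNIV_parts by (auto simp: excess_mass_def)
  then show "r \<le> excess_mass"
    using A measure_parts[OF A(1)] measure_nonneg[of left_excess A] measure_nonneg[of right_excess A] by linarith
qed

text \<open>
  On the diagonal the coupling is dominated by both marginals, hence by \<open>overlap\<close>; maximality makes
  the total masses agree.
\<close>

lemma measure_Times_maximal_independent:
  assumes max: "maximal_coupling \<mu> \<nu> \<gamma>" and ind: "conditionally_independent_off_diagonal \<gamma>"
    and [measurable]: "A \<in> sets borel" "B \<in> sets borel"
  shows "measure \<gamma> (A \<times> B) = measure overlap (A \<inter> B) + measure left_excess A * measure right_excess B / excess_mass"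
proof -
  have "prob_space \<gamma>" and sets_\<gamma>[measurable_cong]: "sets \<gamma> = sets (borel \<Otimes>\<^sub>M borel)"
    and d1: "distr \<gamma> borel fst = \<mu>" and d2: "distr \<gamma> borel snd = \<nu>"
    using max by (auto simp: maximal_coupling_def coupling_def)
  interpret prob_space \<gamma> by fact
  have space_\<gamma>: "space \<gamma> = UNIV"
    using sets_eq_imp_space_eq[OF sets_\<gamma>] by (simp add: space_pair_measure)
  define N where "N = {p::'a \<times> 'a. fst p \<noteq> snd p}"
  have N[measurable]: "N \<in> sets \<gamma>"
    unfolding N_def sets_\<gamma> borel_prod by (intro borel_open open_Collect_neq) (auto intro: continuous_intros)
  have rect[measurable]: "A \<times> B \<in> sets \<gamma>" if "A \<in> sets borel" "B \<in> sets borel" for A B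
    using that by (simp add: sets_\<gamma>)
  have D: "prob (- N) = 1 - excess_mass"
    using max total_variation_eq by (simp add: maximal_coupling_def space_\<gamma> N_def Compl_eq)
  then have Nc: "prob N = excess_mass" using prob_compl[OF N] by (simp add: space_\<gamma> Compl_eq_Diff_UNIV)
  have \<mu>: "measure \<mu> A = prob (A \<times> UNIV)" and \<nu>: "measure \<nu> A = prob (UNIV \<times> A)"
    if "A \<in> sets borel" for A
    using that by (auto simp: d1[symmetric] d2[symmetric] measure_distr space_\<gamma>
      measurable_cong_sets[OF sets_\<gamma> refl] intro!: arg_cong[where f=prob])
  have split: "prob S = prob (S - N) + prob (N \<inter> S)" if [measurable]: "S \<in> sets \<gamma>" for S
    by (subst finite_measure_Union[symmetric]) (auto intro!: arg_cong[where f=prob])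
  \<comment> \<open>The mass that \<open>\<gamma>\<close> puts on the diagonal over
    \<open>A\<close>, regarded as a set function of \<open>A\<close>.\<close>
  define \<delta> where "\<delta> A = prob (A \<times> A - N)" for A
  have diag: "A \<times> B - N = (A \<inter> B) \<times> (A \<inter> B) - N" for A B by (auto simp: N_def)
  have \<delta>_add: "\<delta> A = \<delta> (A \<inter> E) + \<delta> (A - E)"
    if [measurable]: "A \<in> sets borel" "E \<in> sets borel" for A E
  proof -
    have "A \<times> A - N = ((A \<inter> E) \<times> (A \<inter> E) - N) \<union> ((A - E) \<times> (A - E) - N)"
      by (auto simp: N_def)
    then show ?thesis
      unfolding \<delta>_def by (simp only:, subst finite_measure_Union) auto
  qed
  have \<delta>_le: "\<delta> A \<le> measure \<mu> A" "\<delta> A \<le> measure \<nu> A" if [measurable]: "A \<in> sets borel" for A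
    unfolding \<delta>_def using that by (auto simp: \<mu> \<nu> intro!: finite_measure_mono)
  \<comment> \<open>On \<open>?E\<close> the measure \<open>overlap\<close> agrees with
    \<open>\<nu>\<close>, off \<open>?E\<close> with \<open>\<mu>\<close>. Bounding each piece by
    the marginal that fits therefore gives the bound by \<open>overlap\<close>.\<close>
  have \<delta>_le_overlap: "\<delta> A \<le> measure overlap A" if [measurable]: "A \<in> sets borel" for A
  proof -
    let ?E = "{z. g z < f z}"
    have "\<delta> A = \<delta> (A \<inter> ?E) + \<delta> (A - ?E)" by (rule \<delta>_add) auto
    also have "\<dots> \<le> measure \<nu> (A \<inter> ?E) + measure \<mu> (A - ?E)"
      by (intro add_mono \<delta>_le) auto
    also have "\<dots> = measure overlap (A \<inter> ?E) + measure overlap (A - ?E)"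
      by (simp add: measure_parts measure_excess_null)
    also have "\<dots> = measure overlap A"
      by (subst overlap.finite_measure_Union[symmetric]) (auto intro!: arg_cong[where f="measure overlap"])
    finally show ?thesis .
  qed
  \<comment> \<open>The inequality holds for \<open>A\<close> and for its complement, and both sides
    have total mass \<open>1 - excess_mass\<close>; so neither inequality can be strict.\<close>
  have \<delta>: "\<delta> A = measure overlap A" if [measurable]: "A \<in> sets borel" for A
  proof -
    have "\<delta> A + \<delta> (- A) = 1 - excess_mass"
      using \<delta>_add[of UNIV A] D by (simp add: \<delta>_def Compl_eq_Diff_UNIV)
    moreover have "measure overlap A + measure overlap (- A) = 1 - excess_mass"
      using overlap.finite_measure_compl[of A] measure_UNIV_parts by (simp add: Compl_eq_Diff_UNIV)
    ultimately show ?thesis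
      using \<delta>_le_overlap[of A] \<delta>_le_overlap[of "- A"] by auto
  qed
  \<comment> \<open>With the diagonal part known to be \<open>overlap\<close>, what remains of each
    marginal off the diagonal is its excess.\<close>
  have "prob (N \<inter> A \<times> UNIV) = measure left_excess A"
    using split[of "A \<times> UNIV"] \<mu>[of A] \<delta>[of A] measure_parts[of A] diag[of A UNIV]
    by (simp add: \<delta>_def)
  moreover have "prob (N \<inter> UNIV \<times> B) = measure right_excess B"
    using split[of "UNIV \<times> B"] \<nu>[of B] \<delta>[of B] measure_parts[of B] diag[of UNIV B]
    by (simp add: \<delta>_def)
  ultimately have "prob (N \<inter> A \<times> B) * excess_mass = measure left_excess A * measure right_excess B"
    using ind conditionally_independent_off_diagonal_iff[OF \<open>prob_space \<gamma>\<close> sets_\<gamma>] excess_mass_pos Nc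
    by (simp add: N_def)
  moreover have "prob (A \<times> B - N) = measure overlap (A \<inter> B)"
    using \<delta>[of "A \<inter> B"] diag[of A B] by (simp add: \<delta>_def)
  ultimately show ?thesis
    using split[of "A \<times> B"] excess_mass_pos by (simp add: field_simps)
qed

text \<open>The criterion is phrased with integrals because the law of a sampler is computed in that
  form. Existence is read off by inserting indicators. Uniqueness holds because
  \<open>measure_Times_maximal_independent\<close> fixes every maximal independent coupling on
  rectangles.\<close>

lemma is_maximal_independent_couplingI:
  assumes sets_\<gamma>[measurable_cong]: "sets \<gamma> = sets (borel \<Otimes>\<^sub>M borel)"
    and integral: "\<And>F. F \<in> borel_measurable (borel \<Otimes>\<^sub>M borel) \<Longrightarrow>
      (\<integral>\<^sup>+p. F p \<partial>\<gamma>) = (\<integral>\<^sup>+z. F (z, z) \<partial>overlap) + (\<integral>\<^sup>+u. \<integral>\<^sup>+v. F (u, v) \<partial>right_excess \<partial>left_excess) / ennreal excess_mass"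
  shows "is_maximal_independent_coupling \<mu> \<nu> \<gamma>"
proof -
  have space_\<gamma>: "space \<gamma> = UNIV"
    using sets_eq_imp_space_eq[OF sets_\<gamma>] by (simp add: space_pair_measure)
  define N where "N = {p::'a \<times> 'a. fst p \<noteq> snd p}"
  have N0[measurable]: "N \<in> sets (borel \<Otimes>\<^sub>M borel)"
    unfolding N_def borel_prod by (intro borel_open open_Collect_neq) (auto intro: continuous_intros)
  then have N[measurable]: "N \<in> sets \<gamma>" by (simp add: sets_\<gamma>)
  have rect[measurable]: "A \<times> B \<in> sets \<gamma>" if "A \<in> sets borel" "B \<in> sets borel" for A B
    using that by (simp add: sets_\<gamma>)
  have em: "emeasure \<gamma> S = (\<integral>\<^sup>+z. indicator S (z, z) \<partial>overlap) + (\<integral>\<^sup>+u. \<integral>\<^sup>+v. indicator S (u, v) \<partial>right_excess \<partial>left_excess) / ennreal excess_mass"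
    if "S \<in> sets \<gamma>" for S
    using that integral[of "indicator S"] by (simp add: sets_\<gamma>)
  have prod: "(\<integral>\<^sup>+u. \<integral>\<^sup>+v. indicator (A \<times> B) (u, v) \<partial>right_excess \<partial>left_excess) = emeasure left_excess A * emeasure right_excess B"
    if "A \<in> sets borel" "B \<in> sets borel" for A B
    using that by (simp add: indicator_times nn_integral_cmult nn_integral_multc)
  \<comment> \<open>The product of the excesses does not charge the diagonal: for
    \<open>g u < f u\<close> the sets \<open>A \<times> B\<close> and
    \<open>N \<inter> A \<times> B\<close> differ in the section at \<open>u\<close> at most by the
    point \<open>v = u\<close>, where the density of \<open>right_excess\<close> is zero. The
    \<open>overlap\<close> term lives on the diagonal and contributes nothing to
    \<open>N\<close>.\<close>
  have off: "emeasure \<gamma> (N \<inter> A \<times> B) = ennreal (measure left_excess A * measure right_excess B / excess_mass)"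
    if [measurable]: "A \<in> sets borel" "B \<in> sets borel" for A B
  proof -
    have "(\<integral>\<^sup>+v. indicator (N \<inter> A \<times> B) (u, v) \<partial>right_excess) = (\<integral>\<^sup>+v. indicator (A \<times> B) (u, v) \<partial>right_excess)" if "g u < f u" for u
      using that unfolding right_excess_def
      by (auto simp: nn_integral_density N_def indicator_def max_def intro!: nn_integral_cong)
    moreover have "AE u in left_excess. g u < f u"
      unfolding left_excess_def by (subst AE_density) (auto simp: max_def)
    ultimately have "(\<integral>\<^sup>+u. \<integral>\<^sup>+v. indicator (N \<inter> A \<times> B) (u, v) \<partial>right_excess \<partial>left_excess) =
        (\<integral>\<^sup>+u. \<integral>\<^sup>+v. indicator (A \<times> B) (u, v) \<partial>right_excess \<partial>left_excess)"
      by (intro nn_integral_cong_AE) (auto elim: eventually_mono)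
    moreover have "(\<lambda>z. indicator (N \<inter> A \<times> B) (z, z) :: ennreal) = (\<lambda>_. 0)"
      by (auto simp: N_def)
    ultimately show ?thesis
      using that excess_mass_pos by (simp add: em prod left_excess.emeasure_eq_measure right_excess.emeasure_eq_measure
        ennreal_mult[symmetric] divide_ennreal)
  qed
  have em_rect: "emeasure \<gamma> (A \<times> B) = ennreal (measure overlap (A \<inter> B) + measure left_excess A * measure right_excess B / excess_mass)"
    if [measurable]: "A \<in> sets borel" "B \<in> sets borel" for A B
  proof -
    have "(\<integral>\<^sup>+z. indicator (A \<times> B) (z, z) \<partial>overlap) = (\<integral>\<^sup>+z. indicator (A \<inter> B) z \<partial>overlap)"
      by (intro nn_integral_cong) (auto simp: indicator_def)
    then show ?thesis
      using that excess_mass_pos by (simp add: em prod left_excess.emeasure_eq_measure right_excess.emeasure_eq_measure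
        overlap.emeasure_eq_measure ennreal_mult[symmetric] divide_ennreal)
  qed
  have prob: "prob_space \<gamma>"
    using em_rect[of UNIV UNIV] measure_UNIV_parts excess_mass_pos
    by (intro prob_spaceI) (simp add: space_\<gamma> excess_mass_def)
  interpret prob_space \<gamma> by (rule prob)
  have off': "prob (N \<inter> A \<times> B) = measure left_excess A * measure right_excess B / excess_mass"
    if [measurable]: "A \<in> sets borel" "B \<in> sets borel" for A B
    using off[of A B] excess_mass_pos by (simp add: emeasure_eq_measure)
  have Nc: "prob N = excess_mass"
    using off'[of UNIV UNIV] measure_UNIV_parts by (simp add: excess_mass_def)
  have "distr \<gamma> borel fst = \<mu>" "distr \<gamma> borel snd = \<nu>"
  proof (rule_tac [!] measure_eqI)
    fix A :: "'a set" assume "A \<in> sets (distr \<gamma> borel fst)"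
    then have [measurable]: "A \<in> sets borel" by simp
    have "fst -` A = A \<times> (UNIV::'a set)" by auto
    then show "emeasure (distr \<gamma> borel fst) A = emeasure \<mu> A"
      using excess_mass_pos by (simp add: emeasure_distr measurable_cong_sets[OF sets_\<gamma> refl] space_\<gamma> em_rect
        \<mu>.emeasure_eq_measure measure_parts measure_UNIV_parts)
  next
    fix A :: "'a set" assume "A \<in> sets (distr \<gamma> borel snd)"
    then have [measurable]: "A \<in> sets borel" by simp
    have "snd -` A = (UNIV::'a set) \<times> A" by auto
    then show "emeasure (distr \<gamma> borel snd) A = emeasure \<nu> A"
      using excess_mass_pos by (simp add: emeasure_distr measurable_cong_sets[OF sets_\<gamma> refl] space_\<gamma> em_rect
        \<nu>.emeasure_eq_measure measure_parts excess_mass_def[symmetric])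
  qed simp_all
  moreover have "prob {p \<in> space \<gamma>. fst p = snd p} = 1 - excess_mass"
    using prob_compl[OF N] Nc by (simp add: space_\<gamma> N_def set_diff_eq)
  ultimately have max: "maximal_coupling \<mu> \<nu> \<gamma>"
    by (simp add: maximal_coupling_def coupling_def prob sets_\<gamma> total_variation_eq)
  have ind: "conditionally_independent_off_diagonal \<gamma>"
    using excess_mass_pos Nc off' measure_UNIV_parts
    by (subst conditionally_independent_off_diagonal_iff[OF prob sets_\<gamma>])
       (simp_all add: N_def[symmetric] excess_mass_def[symmetric])
  have "\<gamma>' = \<gamma>" if \<gamma>': "maximal_coupling \<mu> \<nu> \<gamma>'" "conditionally_independent_off_diagonal \<gamma>'" for \<gamma>'
  proof -
    have "prob_space \<gamma>'" and sets_\<gamma>': "sets \<gamma>' = sets (borel \<Otimes>\<^sub>M borel)"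
      using \<gamma>' by (auto simp: maximal_coupling_def coupling_def)
    interpret \<gamma>': prob_space \<gamma>' by fact
    show ?thesis
    \<comment> \<open>Measurable rectangles form an intersection-stable generator of the product
      sigma-algebra, so agreement on them suffices.\<close>
    proof (rule measure_eqI_generator_eq[where E="{A \<times> B |A B. A \<in> sets (borel::'a measure) \<and> B \<in> sets (borel::'a measure)}"
          and \<Omega>="UNIV \<times> UNIV" and A="\<lambda>_. UNIV"])
      show "Int_stable {A \<times> B |A B. A \<in> sets (borel::'a measure) \<and> B \<in> sets (borel::'a measure)}"
        by (rule Int_stable_pair_measure_generator)
      fix X assume "X \<in> {A \<times> B |A B. A \<in> sets (borel::'a measure) \<and> B \<in> sets (borel::'a measure)}"
      then obtain A B where "X = A \<times> B" "A \<in> sets borel" "B \<in> sets borel" by auto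
      then show "emeasure \<gamma>' X = emeasure \<gamma> X"
        using measure_Times_maximal_independent[OF \<gamma>'] measure_Times_maximal_independent[OF max ind]
        by (simp add: emeasure_eq_measure \<gamma>'.emeasure_eq_measure)
    qed (auto simp: sets_\<gamma> sets_\<gamma>' sets_pair_measure intro!: exI[of _ UNIV])
  qed
  with max ind show ?thesis
    unfolding is_maximal_independent_coupling_def by blast
qed

end

section \<open>Rejection sampling\<close>

text \<open>
  With \<open>p\<close> the acceptance probability, conditioning on the first draw gives
  \<open>P (T A) = Q (E \<inter> A) + (1 - p) P (T A)\<close> for the event \<open>T A\<close> that some draw is accepted and the
  first such draw lies in \<open>A\<close>; the case \<open>A = space Q\<close> shows that almost surely some draw is accepted.
\<close>

lemma distr_first_accepted:
  fixes Q :: "'b measure"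
  assumes "prob_space Q" and E[measurable]: "Measurable.pred Q E"
    and pos: "measure Q {q\<in>space Q. E q} > 0"
  shows "distr (\<Pi>\<^sub>M k\<in>(UNIV::nat set). Q) Q (\<lambda>\<omega>. \<omega> (LEAST k. E (\<omega> k))) = uniform_measure Q {q\<in>space Q. E q}"
proof -
  interpret Q: prob_space Q by fact
  interpret S: sequence_space Q ..
  let ?S = "\<Pi>\<^sub>M k\<in>(UNIV::nat set). Q"
  interpret QS: pair_prob_space Q ?S ..
  define L where "L \<omega> = (LEAST k. E (\<omega> k))" for \<omega> :: "nat \<Rightarrow> 'b"
  define p where "p = Q.prob {q\<in>space Q. E q}"
  have L[measurable]: "L \<in> measurable ?S (count_space UNIV)"
    unfolding L_def by measurable
  have first[measurable]: "(\<lambda>\<omega>. \<omega> (L \<omega>)) \<in> measurable ?S Q"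
    by (rule measurable_compose_countable[where f="\<lambda>k \<omega>. \<omega> k", OF _ L]) simp
  \<comment> \<open>Existence of an accepted draw is part of the event, since the index chosen by
    \<open>LEAST\<close> is arbitrary otherwise.\<close>
  define T where "T A = {\<omega>\<in>space ?S. (\<exists>k. E (\<omega> k)) \<and> \<omega> (L \<omega>) \<in> A}" for A
  have T[measurable]: "T A \<in> sets ?S" if [measurable]: "A \<in> sets Q" for A
    unfolding T_def by measurable
  have case_nat_meas[measurable]: "(\<lambda>(s, \<omega>). case_nat s \<omega>) \<in> measurable (Q \<Otimes>\<^sub>M ?S) ?S"
    by measurable
  \<comment> \<open>\<open>case_nat s \<omega>\<close> prepends the draw \<open>s\<close>. Either
    \<open>s\<close> is accepted and is the first such draw, or the search continues in
    \<open>\<omega>\<close> with all indices raised by one.\<close>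
  have shift: "case_nat s \<omega> \<in> T A \<longleftrightarrow> E s \<and> s \<in> A \<or> \<not> E s \<and> \<omega> \<in> T A"
    if "s \<in> space Q" "\<omega> \<in> space ?S" for s \<omega> A
  proof -
    have sp: "case_nat s \<omega> \<in> space ?S" using that by (auto simp: space_PiM PiE_iff split: nat.split)
    have "L (case_nat s \<omega>) = 0" if "E s"
      unfolding L_def using that by (intro Least_equality) auto
    moreover have "L (case_nat s \<omega>) = Suc (L \<omega>)" if "\<not> E s" "E (\<omega> k)" for k
      unfolding L_def using that Least_Suc[of "\<lambda>k. E (case_nat s \<omega> k)" "Suc k"] by simp
    moreover have "(\<exists>k. E (case_nat s \<omega> k)) \<longleftrightarrow> E s \<or> (\<exists>k. E (\<omega> k))"
      by (metis not0_implies_Suc old.nat.simps(4,5))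
    ultimately show ?thesis
      using that sp by (cases "E s") (auto simp: T_def)
  qed
  have prob_T: "S.prob (T A) = Q.prob ({q\<in>space Q. E q} \<inter> A) / p" if A[measurable]: "A \<in> sets Q" for A
  proof -
    let ?U = "({q\<in>space Q. E q} \<inter> A) \<times> space ?S" and ?V = "{q\<in>space Q. \<not> E q} \<times> T A"
    \<comment> \<open>Prepending an independent fresh draw does not change the law of the sequence;
      this is the source of the recursion for \<open>T A\<close>.\<close>
    have "S.prob (T A) = measure (distr (Q \<Otimes>\<^sub>M ?S) ?S (\<lambda>(s, \<omega>). case_nat s \<omega>)) (T A)"
      by (subst S.PiM_iter) simp
    also have "\<dots> = measure (Q \<Otimes>\<^sub>M ?S) ((\<lambda>(s, \<omega>). case_nat s \<omega>) -` T A \<inter> space (Q \<Otimes>\<^sub>M ?S))"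
      by (rule measure_distr) auto
    also have "(\<lambda>(s, \<omega>). case_nat s \<omega>) -` T A \<inter> space (Q \<Otimes>\<^sub>M ?S) = ?U \<union> ?V"
      using sets.sets_into_space[OF A] sets.sets_into_space[OF T[OF A]]
      by (auto simp: space_pair_measure shift)
    also have "measure (Q \<Otimes>\<^sub>M ?S) (?U \<union> ?V) = measure (Q \<Otimes>\<^sub>M ?S) ?U + measure (Q \<Otimes>\<^sub>M ?S) ?V"
      by (rule QS.finite_measure_Union) (auto intro!: pair_measureI)
    also have "\<dots> = Q.prob ({q\<in>space Q. E q} \<inter> A) + Q.prob {q\<in>space Q. \<not> E q} * S.prob (T A)"
      by (simp add: S.emeasure_pair_measure_Times measure_def enn2real_mult S.emeasure_space_1)
    also have "Q.prob {q\<in>space Q. \<not> E q} = 1 - p"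
      unfolding p_def by (rule Q.prob_neg) simp
    finally have "p * S.prob (T A) = Q.prob ({q\<in>space Q. E q} \<inter> A)"
      by (simp add: algebra_simps)
    then show ?thesis
      using pos by (simp add: p_def field_simps)
  qed
  have "S.prob (T (space Q)) = 1"
    using prob_T[of "space Q"] pos by (simp add: p_def Int_absorb2 Collect_conj_eq Int_commute)
  then have AE_accept: "AE \<omega> in ?S. \<exists>k. E (\<omega> k)"
    using S.AE_in_set_eq_1[of "T (space Q)"] by (auto simp: T_def elim: eventually_mono)
  show ?thesis unfolding L_def[symmetric]
  proof (rule measure_eqI)
    fix A assume "A \<in> sets (distr ?S Q (\<lambda>\<omega>. \<omega> (L \<omega>)))"
    then have A[measurable]: "A \<in> sets Q" by simp
    have "emeasure (distr ?S Q (\<lambda>\<omega>. \<omega> (L \<omega>))) A = emeasure ?S {\<omega>\<in>space ?S. \<omega> (L \<omega>) \<in> A}"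
      by (subst emeasure_distr) (auto intro!: arg_cong[where f="emeasure ?S"])
    \<comment> \<open>Sequences without an accepted draw form a null set, so the unspecified value
      there carries no weight.\<close>
    also have "\<dots> = emeasure ?S (T A)"
      using AE_accept by (intro emeasure_eq_AE) (auto simp: T_def)
    also have "\<dots> = ennreal (Q.prob ({q\<in>space Q. E q} \<inter> A) / p)"
      by (simp add: S.emeasure_eq_measure prob_T)
    also have "\<dots> = emeasure (uniform_measure Q {q\<in>space Q. E q}) A"
      using pos by (simp add: Q.emeasure_eq_measure divide_ennreal p_def)
    finally show "emeasure (distr ?S Q (\<lambda>\<omega>. \<omega> (L \<omega>))) A = emeasure (uniform_measure Q {q\<in>space Q. E q}) A" .
  qed simp
qed

section \<open>The acceptance test with a uniform threshold\<close>

lemma sets_unif01[measurable_cong, simp]: "sets unif01 = sets borel"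
  by (simp add: unif01_def)

lemma space_unif01[simp]: "space unif01 = UNIV"
  by (simp add: unif01_def)

lemma prob_space_unif01: "prob_space unif01"
  unfolding unif01_def by (rule prob_space_uniform_measure) auto

text \<open>The event has probability \<open>min 1 (b / a)\<close>. Multiplying by the proposal
  density \<open>a\<close> turns the acceptance test directly into the density
  \<open>min a b\<close>.\<close>

lemma unif01_mult_le:
  assumes "0 < a" "0 \<le> b"
  shows "ennreal a * emeasure unif01 {w. w * a \<le> b} = ennreal (min a b)"
proof -
  have "{0..1} \<inter> {w. w * a \<le> b} = {0..min 1 (b / a)}"
    using assms by (auto simp: field_simps)
  then have "emeasure unif01 {w. w * a \<le> b} = emeasure lborel {0..min 1 (b / a)}"
    by (simp add: unif01_def divide_ennreal_def)
  also have "\<dots> = ennreal (min 1 (b / a))" using assms by simp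
  finally show ?thesis
    using assms by (auto simp: ennreal_mult[symmetric] min_def field_simps)
qed

text \<open>The complementary event, with \<open>a - min a b = max 0 (a - b)\<close>.\<close>

lemma unif01_mult_gr:
  assumes "0 < a" "0 \<le> b"
  shows "ennreal a * emeasure unif01 {w. b < w * a} = ennreal (max 0 (a - b))"
proof -
  interpret prob_space unif01 by (rule prob_space_unif01)
  have "measure unif01 {w. w * a \<le> b} = min a b / a"
    using unif01_mult_le[OF assms] assms
    by (auto simp: emeasure_eq_measure ennreal_mult[symmetric] field_simps)
  moreover have "measure unif01 {w. b < w * a} = 1 - measure unif01 {w. w * a \<le> b}"
    using prob_compl[of "{w. w * a \<le> b}"] by (simp add: Compl_eq_Diff_UNIV[symmetric] Compl_eq not_le)
  ultimately have "measure unif01 {w. b < w * a} = max 0 (a - b) / a"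
    using assms by (auto simp: min_def max_def diff_divide_distrib)
  then show ?thesis
    using assms by (simp add: emeasure_eq_measure ennreal_mult[symmetric])
qed

section \<open>The rejection procedure for two normal laws on the line\<close>

lemma nn_integral_normal_density:
  assumes "0 < s"
  shows "(\<integral>\<^sup>+z. ennreal (normal_density m s z) \<partial>lborel) = 1"
  using prob_space.emeasure_space_1[OF prob_space_normal_density[OF assms, of m]]
  by (simp add: emeasure_density)

text \<open>Two normal densities with equal variance and different means agree only at the midpoint
  of the means, which is a null set.\<close>

lemma density_pair_normal:
  assumes "0 < s" "x \<noteq> y"
  shows "density_pair (normal_density x s) (normal_density y s)"
proof
  show "(\<integral>\<^sup>+z. ennreal (normal_density x s z) \<partial>lborel) = 1"
    "(\<integral>\<^sup>+z. ennreal (normal_density y s z) \<partial>lborel) = 1"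
    by (rule nn_integral_normal_density[OF assms(1)])+
  show "\<not> (AE z in lborel. normal_density x s z = normal_density y s z)"
  proof
    assume "AE z in lborel. normal_density x s z = normal_density y s z"
    with AE_lborel_singleton[of "(x + y) / 2"] have "AE z::real in lborel. False"
    proof eventually_elim
      case (elim z)
      then have "(z - x)\<^sup>2 = (z - y)\<^sup>2" using assms by (simp add: normal_density_def)
      then show ?case using elim assms by (auto simp: power2_eq_iff field_simps)
    qed
    then have "emeasure lborel (UNIV :: real set) = 0"
      by (simp add: AE_iff_measurable[of UNIV])
    then show False by simp
  qed
qed auto

text \<open>This puts the law into the shape required by
  \<open>is_maximal_independent_couplingI\<close>. Accepting the first draw has weight
  \<open>min f g\<close> and rejecting it has weight \<open>(f - g)\<close>, cut off at zero; after
  a rejection the loop returns a draw from the normalised \<open>right_excess\<close>, independently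
  of the rejected value.\<close>

lemma nn_integral_rejection_law:
  assumes s: "0 < s" and "x1 \<noteq> y1" and F[measurable]: "F \<in> borel_measurable (borel \<Otimes>\<^sub>M borel)"
  shows "(\<integral>\<^sup>+p. F p \<partial>rejection_law x1 y1 s) =
    (\<integral>\<^sup>+z. F (z, z) \<partial>density_pair.overlap (normal_density x1 s) (normal_density y1 s)) +
    (\<integral>\<^sup>+u. \<integral>\<^sup>+v. F (u, v) \<partial>density_pair.right_excess (normal_density x1 s) (normal_density y1 s)
                     \<partial>density_pair.left_excess (normal_density x1 s) (normal_density y1 s)) /
    ennreal (density_pair.excess_mass (normal_density x1 s) (normal_density y1 s))"
proof -
  define f where "f = normal_density x1 s"
  define g where "g = normal_density y1 s"
  interpret density_pair f g unfolding f_def g_def using assms(1,2) by (rule density_pair_normal)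
  have pos: "0 < f z" "0 < g z" for z using s by (simp_all add: f_def g_def normal_density_pos)
  have law: "normal_law x1 s = \<mu>" "normal_law y1 s = \<nu>"
    unfolding normal_law_def \<mu>_def \<nu>_def unfolding f_def g_def by (rule refl)+
  interpret U: prob_space unif01 by (rule prob_space_unif01)
  interpret Q: pair_prob_space \<nu> unif01 ..
  interpret X: pair_prob_space \<mu> unif01 ..
  let ?Q = "\<nu> \<Otimes>\<^sub>M unif01"
  let ?S = "\<Pi>\<^sub>M k\<in>(UNIV::nat set). ?Q"
  interpret S: product_prob_space "\<lambda>_. ?Q" "UNIV :: nat set" ..
  interpret S: prob_space ?S by (rule S.P.prob_space_axioms) 
  define E where "E = rejection_accepts x1 y1 s"
  have E_iff: "E (v, w) \<longleftrightarrow> f v < w * g v" for v w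
    by (simp add: E_def rejection_accepts_def f_def g_def)
  have E[measurable]: "Measurable.pred ?Q E"
    unfolding E_def rejection_accepts_def f_def[symmetric] g_def[symmetric] by measurable
  then have E_sets[measurable]: "{q. E q} \<in> sets ?Q"
    by (simp add: pred_def space_pair_measure)
  define L where "L \<omega> = (LEAST k. E (\<omega> k))" for \<omega> :: "nat \<Rightarrow> real \<times> real"
  have L[measurable]: "L \<in> measurable ?S (count_space UNIV)"
    unfolding L_def by measurable
  have first[measurable]: "(\<lambda>\<omega>. \<omega> (L \<omega>)) \<in> measurable ?S ?Q"
    by (rule measurable_compose_countable[where f="\<lambda>k \<omega>. \<omega> k", OF _ L]) simp
  have out: "rejection_output x1 y1 s = (\<lambda>((t, w), \<omega>). (t, if w * f t \<le> g t then t else fst (\<omega> (L \<omega>))))"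
    by (simp add: rejection_output_def f_def g_def E_def L_def cong: if_cong)
  have first_snd[measurable]: "(\<lambda>p. snd p (L (snd p))) \<in> measurable ((\<mu> \<Otimes>\<^sub>M unif01) \<Otimes>\<^sub>M ?S) ?Q"
    using measurable_compose[OF measurable_snd first] by simp
  have out_measurable[measurable]:
    "rejection_output x1 y1 s \<in> measurable ((\<mu> \<Otimes>\<^sub>M unif01) \<Otimes>\<^sub>M ?S) (borel \<Otimes>\<^sub>M borel)"
    unfolding out case_prod_beta by measurable

  \<comment> \<open>The proposal density \<open>g v\<close> times the acceptance probability at
    \<open>v\<close> is the density of \<open>right_excess\<close>, by
    \<open>unif01_mult_gr\<close>.\<close>
  have accept: "(\<integral>\<^sup>+q. H (fst q) * indicator {q. E q} q \<partial>?Q) = (\<integral>\<^sup>+v. H v \<partial>right_excess)"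
    if [measurable]: "H \<in> borel_measurable borel" for H
  proof -
    have "(\<integral>\<^sup>+q. H (fst q) * indicator {q. E q} q \<partial>?Q) =
        (\<integral>\<^sup>+v. \<integral>\<^sup>+w. H v * indicator {w. f v < w * g v} w \<partial>unif01 \<partial>\<nu>)"
      by (subst U.nn_integral_fst[symmetric]) (auto simp: E_iff indicator_def intro!: nn_integral_cong)
    also have "\<dots> = (\<integral>\<^sup>+v. H v * emeasure unif01 {w. f v < w * g v} \<partial>\<nu>)"
      by (simp add: nn_integral_cmult)
    also have "\<dots> = (\<integral>\<^sup>+v. H v * (ennreal (g v) * emeasure unif01 {w. f v < w * g v}) \<partial>lborel)"
      unfolding \<nu>_def by (subst nn_integral_density) (auto simp: ac_simps)
    also have "\<dots> = (\<integral>\<^sup>+v. H v \<partial>right_excess)"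
      unfolding right_excess_def by (subst nn_integral_density) (auto simp: unif01_mult_gr pos less_imp_le ac_simps)
    finally show ?thesis .
  qed
  have space_E: "{q\<in>space ?Q. E q} = {q. E q}"
    by (simp add: space_pair_measure)
  \<comment> \<open>One round of the loop accepts with probability \<open>excess_mass\<close>; this
    is the case \<open>H = 1\<close> of the preceding identity, and it supplies the normalising
    constant.\<close>
  have QE: "emeasure ?Q {q. E q} = ennreal excess_mass"
    using accept[of "\<lambda>_. 1"] measure_UNIV_parts nn_integral_indicator[OF E_sets]
    by (simp add: right_excess.emeasure_eq_measure space_pair_measure)
  have first_law: "(\<integral>\<^sup>+\<omega>. H (fst (\<omega> (L \<omega>))) \<partial>?S) = (\<integral>\<^sup>+v. H v \<partial>right_excess) / ennreal excess_mass"
    if [measurable]: "H \<in> borel_measurable borel" for H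
  proof -
    have "(\<integral>\<^sup>+\<omega>. H (fst (\<omega> (L \<omega>))) \<partial>?S) = (\<integral>\<^sup>+q. H (fst q) \<partial>distr ?S ?Q (\<lambda>\<omega>. \<omega> (L \<omega>)))"
      by (subst nn_integral_distr) auto
    also have "distr ?S ?Q (\<lambda>\<omega>. \<omega> (L \<omega>)) = uniform_measure ?Q {q. E q}"
      unfolding L_def space_E[symmetric] using QE excess_mass_pos
      by (intro distr_first_accepted Q.prob_space_axioms E) (simp add: measure_def space_E)
    also have "(\<integral>\<^sup>+q. H (fst q) \<partial>uniform_measure ?Q {q. E q}) = (\<integral>\<^sup>+v. H v \<partial>right_excess) / ennreal excess_mass"
      by (subst nn_integral_uniform_measure[OF _ E_sets]) (simp_all add: accept QE)
    finally show ?thesis .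
  qed
  have "(\<integral>\<^sup>+p. F p \<partial>rejection_law x1 y1 s) =
      (\<integral>\<^sup>+p. F (rejection_output x1 y1 s p) \<partial>((\<mu> \<Otimes>\<^sub>M unif01) \<Otimes>\<^sub>M ?S))"
    unfolding rejection_law_def rejection_draws_def law by (subst nn_integral_distr) auto
  also have "\<dots> = (\<integral>\<^sup>+t. \<integral>\<^sup>+w. \<integral>\<^sup>+\<omega>. F (rejection_output x1 y1 s ((t, w), \<omega>)) \<partial>?S \<partial>unif01 \<partial>\<mu>)"
    by (simp add: U.nn_integral_fst[symmetric] S.nn_integral_fst[symmetric])
  \<comment> \<open>If the first draw is kept, the loop draws integrate to one; otherwise only the
    first accepted proposal matters and \<open>first_law\<close> gives its integral.\<close>
  also have "\<dots> = (\<integral>\<^sup>+t. \<integral>\<^sup>+w. F (t, t) * indicator {w. w * f t \<le> g t} w +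
      (\<integral>\<^sup>+v. F (t, v) \<partial>right_excess) / ennreal excess_mass * indicator {w. g t < w * f t} w \<partial>unif01 \<partial>\<mu>)"
    by (intro nn_integral_cong) (auto simp: out indicator_def not_le first_law[of "\<lambda>v. F (_, v)"] S.emeasure_space_1)
  also have "\<dots> = (\<integral>\<^sup>+t. F (t, t) * emeasure unif01 {w. w * f t \<le> g t} +
      (\<integral>\<^sup>+v. F (t, v) \<partial>right_excess) / ennreal excess_mass * emeasure unif01 {w. g t < w * f t} \<partial>\<mu>)"
    by (simp add: nn_integral_add nn_integral_cmult)
  also have "\<dots> = (\<integral>\<^sup>+t. F (t, t) * (ennreal (f t) * emeasure unif01 {w. w * f t \<le> g t}) +
      (\<integral>\<^sup>+v. F (t, v) \<partial>right_excess) / ennreal excess_mass * (ennreal (f t) * emeasure unif01 {w. g t < w * f t}) \<partial>lborel)"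
    unfolding \<mu>_def by (subst nn_integral_density) (auto simp: algebra_simps intro!: nn_integral_cong)
  also have "\<dots> = (\<integral>\<^sup>+t. ennreal (min (f t) (g t)) * F (t, t) +
      ennreal (max 0 (f t - g t)) * ((\<integral>\<^sup>+v. F (t, v) \<partial>right_excess) / ennreal excess_mass) \<partial>lborel)"
    by (simp add: unif01_mult_le unif01_mult_gr pos less_imp_le ac_simps)
  also have "\<dots> = (\<integral>\<^sup>+z. F (z, z) \<partial>overlap) + (\<integral>\<^sup>+u. (\<integral>\<^sup>+v. F (u, v) \<partial>right_excess) / ennreal excess_mass \<partial>left_excess)"
    unfolding overlap_def left_excess_def by (simp add: nn_integral_add nn_integral_density)
  also have "(\<integral>\<^sup>+u. (\<integral>\<^sup>+v. F (u, v) \<partial>right_excess) / ennreal excess_mass \<partial>left_excess) = (\<integral>\<^sup>+u. \<integral>\<^sup>+v. F (u, v) \<partial>right_excess \<partial>left_excess) / ennreal excess_mass"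
    by (simp add: nn_integral_divide)
  finally show ?thesis by (simp add: f_def g_def)
qed

section \<open>Isotropic normal densities along a direction\<close>

text \<open>For a unit vector \<open>e\<close>, the orthogonal projection onto the complement of
  \<open>e\<close>. It is written without matrices so that it is available on every Euclidean space;
  \<open>outer_mult_vector\<close> links it to the matrix in the procedure.\<close>

definition perp :: "'a::euclidean_space \<Rightarrow> 'a \<Rightarrow> 'a" where
  "perp e w = w - (e \<bullet> w) *\<^sub>R e"

lemma perp_measurable[measurable]: "perp e \<in> borel_measurable borel"
  unfolding perp_def by measurable

lemma nn_integral_lborel_shift:
  fixes a :: "'a::euclidean_space"
  assumes [measurable]: "F \<in> borel_measurable borel"
  shows "(\<integral>\<^sup>+z. F (a + z) \<partial>lborel) = (\<integral>\<^sup>+z. F z \<partial>lborel)"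
proof -
  have "(\<integral>\<^sup>+z. F z \<partial>distr lborel borel ((+) a)) = (\<integral>\<^sup>+z. F (a + z) \<partial>lborel)"
    by (rule nn_integral_distr) auto
  then show ?thesis by (simp add: lborel_distr_plus)
qed

text \<open>
  The map \<open>(t, w) \<mapsto> (e \<bullet> w, t e + perp e w)\<close> exchanges \<open>t\<close> with the component of \<open>w\<close> along \<open>e\<close>;
  it is a composition of three shears and a reflection in \<open>t\<close>.
\<close>

lemma nn_integral_exchange:
  fixes e :: "'a::euclidean_space" and G :: "real \<times> 'a \<Rightarrow> ennreal"
  assumes e: "norm e = 1" and G[measurable]: "G \<in> borel_measurable (borel \<Otimes>\<^sub>M borel)"
  shows "(\<integral>\<^sup>+t. \<integral>\<^sup>+w. G (e \<bullet> w, t *\<^sub>R e + perp e w) \<partial>lborel \<partial>lborel) =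
         (\<integral>\<^sup>+t. \<integral>\<^sup>+w. G (t, w) \<partial>lborel \<partial>lborel)"
proof -
  have ee: "e \<bullet> e = 1" using e by (simp add: norm_eq_1)
  have swap: "(\<integral>\<^sup>+t. \<integral>\<^sup>+w. H (t, w) \<partial>lborel \<partial>lborel) = (\<integral>\<^sup>+w. \<integral>\<^sup>+t. H (t, w) \<partial>lborel \<partial>lborel)"
    if [measurable]: "H \<in> borel_measurable (borel \<Otimes>\<^sub>M borel)" for H :: "real \<times> 'a \<Rightarrow> ennreal"
    using lborel_pair.Fubini'[of "\<lambda>w t. H (t, w)"] by simp
  have shear_t: "(\<integral>\<^sup>+t. \<integral>\<^sup>+w. H (e \<bullet> w + t, w) \<partial>lborel \<partial>lborel) = (\<integral>\<^sup>+t. \<integral>\<^sup>+w. H (t, w) \<partial>lborel \<partial>lborel)"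
    if [measurable]: "H \<in> borel_measurable (borel \<Otimes>\<^sub>M borel)" for H :: "real \<times> 'a \<Rightarrow> ennreal"
  proof -
    have "(\<integral>\<^sup>+t. \<integral>\<^sup>+w. H (e \<bullet> w + t, w) \<partial>lborel \<partial>lborel) = (\<integral>\<^sup>+w. \<integral>\<^sup>+t. H (e \<bullet> w + t, w) \<partial>lborel \<partial>lborel)"
      using swap[of "\<lambda>(t, w). H (e \<bullet> w + t, w)"] by simp
    also have "\<dots> = (\<integral>\<^sup>+w. \<integral>\<^sup>+t. H (t, w) \<partial>lborel \<partial>lborel)"
      by (intro nn_integral_cong nn_integral_lborel_shift[of "\<lambda>t. H (t, _)"]) measurable
    finally show ?thesis by (simp add: swap)
  qed
  have shear_w: "(\<integral>\<^sup>+t. \<integral>\<^sup>+w. H (t, (- t) *\<^sub>R e + w) \<partial>lborel \<partial>lborel) = (\<integral>\<^sup>+t. \<integral>\<^sup>+w. H (t, w) \<partial>lborel \<partial>lborel)"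
    if [measurable]: "H \<in> borel_measurable (borel \<Otimes>\<^sub>M borel)" for H :: "real \<times> 'a \<Rightarrow> ennreal"
    by (intro nn_integral_cong nn_integral_lborel_shift[of "\<lambda>w. H (_, w)"]) measurable
  have "(\<integral>\<^sup>+t. \<integral>\<^sup>+w. G (t, w) \<partial>lborel \<partial>lborel) = (\<integral>\<^sup>+t. \<integral>\<^sup>+w. G (e \<bullet> w + t, w) \<partial>lborel \<partial>lborel)"
    by (rule shear_t[symmetric]) measurable
  \<comment> \<open>Replacing \<open>w\<close> by \<open>w - t *\<^sub>R e\<close> lowers
    \<open>e \<bullet> w\<close> by \<open>t\<close>, which cancels the \<open>t\<close> added by
    the first shear.\<close>
  also have "\<dots> = (\<integral>\<^sup>+t. \<integral>\<^sup>+w. G (e \<bullet> w, w - t *\<^sub>R e) \<partial>lborel \<partial>lborel)"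
    using shear_w[of "\<lambda>(t, w). G (e \<bullet> w + t, w)"] by (simp add: inner_add_right inner_diff_right ee)
  also have "\<dots> = (\<integral>\<^sup>+t. \<integral>\<^sup>+w. G (e \<bullet> w, w - (e \<bullet> w + t) *\<^sub>R e) \<partial>lborel \<partial>lborel)"
    using shear_t[of "\<lambda>(t, w). G (e \<bullet> w, w - t *\<^sub>R e)"] by simp
  also have "\<dots> = (\<integral>\<^sup>+t. \<integral>\<^sup>+w. G (e \<bullet> w, t *\<^sub>R e + perp e w) \<partial>lborel \<partial>lborel)"
    \<comment> \<open>The factor \<open>-1\<close> is the reflection of \<open>t\<close>; it turns
      \<open>perp e w - t *\<^sub>R e\<close> into the required sum.\<close>
    by (subst nn_integral_real_affine[where c="-1" and t=0]) (simp_all add: perp_def algebra_simps)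
  finally show ?thesis ..
qed

text \<open>The density of the normal law with mean \<open>m\<close> and covariance
  \<open>s^2\<close> times the identity. The product over coordinates yields its total mass by
  Fubini; the radial form is \<open>iso_density_eq\<close>.\<close>

definition iso_density :: "real \<Rightarrow> 'a::euclidean_space \<Rightarrow> 'a \<Rightarrow> real" where
  "iso_density s m z = (\<Prod>b\<in>Basis. normal_density (m \<bullet> b) s (z \<bullet> b))"

lemma iso_density_measurable[measurable]: "iso_density s m \<in> borel_measurable borel"
  unfolding iso_density_def by measurable

lemma iso_density_eq:
  fixes z :: "'a::euclidean_space"
  shows "iso_density s m z = exp (- (norm (z - m))\<^sup>2 / (2 * s\<^sup>2)) / sqrt (2 * pi * s\<^sup>2) ^ DIM('a)"
proof -
  have "iso_density s m z = exp (\<Sum>b\<in>Basis. - ((z - m) \<bullet> b)\<^sup>2 / (2 * s\<^sup>2)) / sqrt (2 * pi * s\<^sup>2) ^ DIM('a)"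
    by (simp add: iso_density_def normal_density_def exp_sum prod_dividef inner_diff_left prod.distrib power_divide)
  also have "(\<Sum>b\<in>Basis. - ((z - m) \<bullet> b)\<^sup>2 / (2 * s\<^sup>2)) = - (norm (z - m))\<^sup>2 / (2 * s\<^sup>2)"
    unfolding power2_norm_eq_inner euclidean_inner[of "z - m" "z - m"]
    by (simp add: sum_divide_distrib sum_negf power2_eq_square)
  finally show ?thesis .
qed

lemma iso_density_pos: "0 < s \<Longrightarrow> 0 < iso_density s m z"
  by (simp add: iso_density_eq)

lemma nn_integral_iso_density:
  assumes "0 < s"
  shows "(\<integral>\<^sup>+z. ennreal (iso_density s m z) \<partial>lborel) = 1"
  unfolding iso_density_def
  by (subst prod_ennreal[symmetric], simp)
     (subst nn_integral_lborel_prod; simp add: nn_integral_normal_density[OF assms])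

text \<open>Pythagoras for the component of \<open>z - m\<close> along \<open>e\<close> and the
  component orthogonal to it.\<close>

lemma norm_diff_split:
  fixes e :: "'a::euclidean_space"
  assumes "norm e = 1"
  shows "(norm (z - m))\<^sup>2 = (e \<bullet> z - e \<bullet> m)\<^sup>2 + (norm (perp e z - perp e m))\<^sup>2"
proof -
  have ee: "e \<bullet> e = 1" using assms by (simp add: norm_eq_1)
  show ?thesis
    unfolding power2_norm_eq_inner perp_def
    by (simp add: inner_diff_left inner_diff_right ee inner_commute power2_eq_square algebra_simps)
qed

lemma inner_perp: "norm e = 1 \<Longrightarrow> e \<bullet> (t *\<^sub>R e + perp e w) = t"
  by (simp add: perp_def inner_add_right inner_diff_right norm_eq_1)

lemma perp_add: "norm e = 1 \<Longrightarrow> perp e (t *\<^sub>R e + perp e w) = perp e w"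
  by (simp add: perp_def[of e "_ + _"] inner_perp)

text \<open>By Pythagoras, dividing the isotropic density by the one-dimensional density along
  \<open>e\<close> leaves a function of the orthogonal displacement only. The identity is
  cross-multiplied and serves two purposes: moving a point along \<open>e\<close> with the mean
  fixed, and comparing two means at the same point.\<close>

lemma iso_density_perp_eq:
  fixes e :: "'a::euclidean_space"
  assumes e: "norm e = 1" and s: "0 < s" and "perp e z - perp e m = perp e z' - perp e m'"
  shows "iso_density s m z * normal_density (e \<bullet> m') s (e \<bullet> z') = iso_density s m' z' * normal_density (e \<bullet> m) s (e \<bullet> z)"
  unfolding iso_density_eq normal_density_def norm_diff_split[OF e, of z m] norm_diff_split[OF e, of z' m'] assms(3)
  by (simp add: exp_add[symmetric] add_divide_distrib diff_divide_distrib algebra_simps)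

text \<open>Replacing the component along \<open>e\<close> of a normal vector by a variable with
  density \<open>h\<close> exchanges the factor \<open>normal_density (e \<bullet> m) s\<close> of
  its density for \<open>h\<close>. The map of \<open>nn_integral_exchange\<close> makes the
  discarded component \<open>e \<bullet> w\<close> a separate variable, which integrates to
  one.\<close>

lemma nn_integral_normal_recombine:
  fixes e :: "'a::euclidean_space" and F :: "'a \<Rightarrow> ennreal"
  assumes e: "norm e = 1" and s: "0 < s"
    and [measurable]: "h \<in> borel_measurable borel" "F \<in> borel_measurable borel" and h: "\<And>t. 0 \<le> h t"
  shows "(\<integral>\<^sup>+t. \<integral>\<^sup>+w. F (t *\<^sub>R e + perp e w) \<partial>density lborel (\<lambda>z. ennreal (iso_density s m z)) \<partial>density lborel (\<lambda>t. ennreal (h t))) =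
    (\<integral>\<^sup>+z. F z \<partial>density lborel (\<lambda>z. ennreal (h (e \<bullet> z) / normal_density (e \<bullet> m) s (e \<bullet> z) * iso_density s m z)))"
proof -
  let ?f = "iso_density s m" and ?f1 = "normal_density (e \<bullet> m) s"
  have pos: "0 < ?f1 t" for t using s by (simp add: normal_density_pos)
  define r where "r z = h (e \<bullet> z) / ?f1 (e \<bullet> z) * ?f z" for z
  have [measurable]: "r \<in> borel_measurable borel" unfolding r_def by measurable
  have r_nonneg: "0 \<le> r z" for z
    unfolding r_def using h[of "e \<bullet> z"] pos[of "e \<bullet> z"] iso_density_pos[OF s, of m z] by simp
  \<comment> \<open>In the exchanged variables the joint density is a product: the discarded
    component has density \<open>?f1\<close>, the recombined point has density
    \<open>r\<close>.\<close>
  have eq: "h t * ?f w = ?f1 (e \<bullet> w) * r (t *\<^sub>R e + perp e w)" for t w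
  proof -
    let ?z = "t *\<^sub>R e + perp e w"
    have "?f w * ?f1 t = ?f ?z * ?f1 (e \<bullet> w)"
      using iso_density_perp_eq[OF e s, of w m ?z m] unfolding inner_perp[OF e] perp_add[OF e] by simp
    then have "?f w = ?f ?z * ?f1 (e \<bullet> w) / ?f1 t"
      using pos[of t] by (simp add: eq_divide_eq)
    then show ?thesis
      unfolding r_def inner_perp[OF e] by (simp add: ac_simps)
  qed
  have "(\<integral>\<^sup>+t. \<integral>\<^sup>+w. F (t *\<^sub>R e + perp e w) \<partial>density lborel ?f \<partial>density lborel h) =
      (\<integral>\<^sup>+t. \<integral>\<^sup>+w. ennreal (h t * ?f w) * F (t *\<^sub>R e + perp e w) \<partial>lborel \<partial>lborel)"
    using h iso_density_pos[OF s, of m]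
    by (simp add: nn_integral_density nn_integral_cmult[symmetric] ennreal_mult less_imp_le mult.assoc)
  also have "\<dots> = (\<integral>\<^sup>+t. \<integral>\<^sup>+w. ennreal (?f1 (e \<bullet> w)) * (ennreal (r (t *\<^sub>R e + perp e w)) * F (t *\<^sub>R e + perp e w)) \<partial>lborel \<partial>lborel)"
    using pos r_nonneg by (simp add: eq ennreal_mult less_imp_le mult.assoc)
  also have "\<dots> = (\<integral>\<^sup>+u. \<integral>\<^sup>+z. ennreal (?f1 u) * (ennreal (r z) * F z) \<partial>lborel \<partial>lborel)"
    using nn_integral_exchange[OF e, of "\<lambda>(u, z). ennreal (?f1 u) * (ennreal (r z) * F z)"] by simp
  also have "\<dots> = (\<integral>\<^sup>+z. ennreal (r z) * F z \<partial>lborel)"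
    by (simp add: nn_integral_cmult nn_integral_multc nn_integral_normal_density[OF s])
  also have "\<dots> = (\<integral>\<^sup>+z. F z \<partial>density lborel r)"
    by (simp add: nn_integral_density)
  finally show ?thesis unfolding r_def .
qed

section \<open>The coupling in dimension \<open>CARD('n)\<close>\<close>

lemma mvn_eq_iso_density:
  fixes m :: "real^'n::finite"
  assumes "0 < s"
  shows "mvn m (s\<^sup>2 *\<^sub>R mat 1) = density lborel (\<lambda>z. ennreal (iso_density s m z))"
proof -
  have det: "det (s\<^sup>2 *\<^sub>R mat 1 :: real^'n^'n) = (s\<^sup>2) ^ CARD('n)"
    by (subst det_diagonal) (auto simp: mat_def)
  have inv: "matrix_inv (s\<^sup>2 *\<^sub>R mat 1 :: real^'n^'n) = (1 / s\<^sup>2) *\<^sub>R mat 1"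
  proof -
    let ?A = "s\<^sup>2 *\<^sub>R mat 1 :: real^'n^'n" and ?B = "(1 / s\<^sup>2) *\<^sub>R mat 1 :: real^'n^'n"
    have inv: "?A ** ?B = mat 1" "?B ** ?A = mat 1"
      using assms by (simp_all add: scalar_matrix_assoc[symmetric] matrix_scalar_ac)
    \<comment> \<open>\<open>matrix_inv\<close> is defined by choice, so an inverse must be
      exhibited before its defining equation can be used; multiplying by \<open>?B\<close> on the
      left then identifies it.\<close>
    then have ex: "\<exists>C. ?A ** C = mat 1 \<and> C ** ?A = mat 1" by blast
    have right: "?A ** matrix_inv ?A = mat 1"
      using someI_ex[OF ex] unfolding matrix_inv_def by (rule conjunct1)
    have "matrix_inv ?A = (?B ** ?A) ** matrix_inv ?A"
      by (simp only: inv matrix_mul_lid)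
    also have "\<dots> = ?B"
      by (simp only: matrix_mul_assoc[symmetric] right matrix_mul_rid)
    finally show ?thesis .
  qed
  have "mvn_density m (s\<^sup>2 *\<^sub>R mat 1) z = iso_density s m z" for z :: "real^'n"
  proof -
    have "(z - m) \<bullet> (matrix_inv (s\<^sup>2 *\<^sub>R mat 1) *v (z - m)) = (norm (z - m))\<^sup>2 / s\<^sup>2"
      by (simp add: inv scaleR_matrix_vector_assoc[symmetric] power2_norm_eq_inner)
    moreover have "sqrt ((2 * pi) ^ CARD('n) * (s\<^sup>2) ^ CARD('n)) = sqrt (2 * pi * s\<^sup>2) ^ CARD('n)"
      by (simp only: power_mult_distrib[symmetric] real_sqrt_power)
    ultimately show ?thesis
      unfolding mvn_density_def iso_density_eq det by simp
  qed
  then show ?thesis by (simp add: mvn_def)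
qed

lemma outer_mult_vector: "(mat 1 - outer e e) *v w = perp e w"
proof -
  have "outer e e *v w = (e \<bullet> w) *\<^sub>R e"
    by (simp add: vec_eq_iff outer_def matrix_vector_mult_def inner_vec_def sum_distrib_left ac_simps)
  then show ?thesis
    by (simp add: matrix_vector_mult_diff_rdistrib perp_def)
qed

theorem lemma4p1:
  fixes x y :: "real^'n::finite" and \<sigma> :: real
  assumes "\<sigma> > 0" and "x \<noteq> y"
  shows "is_maximal_independent_coupling
           (mvn x (\<sigma>\<^sup>2 *\<^sub>R mat 1)) (mvn y (\<sigma>\<^sup>2 *\<^sub>R mat 1)) (max_indep_law x y \<sigma>)"
proof -
  note s = \<open>\<sigma> > 0\<close>
  define e where "e = direction x y"
  have norm_e: "norm e = 1" using assms by (simp add: e_def direction_def)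
  have yx: "y - x = norm (y - x) *\<^sub>R e" using assms by (simp add: e_def direction_def)
  \<comment> \<open>The projected means differ by the full distance of \<open>x\<close> and
    \<open>y\<close>, so the one-dimensional normal laws are distinct.\<close>
  have "e \<bullet> y - e \<bullet> x = norm (y - x)"
    using norm_e by (simp add: inner_diff_right[symmetric]) (subst yx, simp add: norm_eq_1)
  then have xy1: "e \<bullet> x \<noteq> e \<bullet> y" using assms by auto
  \<comment> \<open>Since \<open>y - x\<close> is a multiple of \<open>e\<close>, the means have the
    same orthogonal component. This is why \<open>f / f1\<close> and \<open>g / g1\<close> agree
    below.\<close>
  have perp_xy: "perp e x = perp e y"
  proof -
    have "perp e (y - x) = 0"
      using norm_e by (subst yx) (simp add: perp_def norm_eq_1)
    then show ?thesis by (simp add: perp_def inner_diff_right algebra_simps)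
  qed
  define f g where "f = iso_density \<sigma> x" and "g = iso_density \<sigma> y"
  define f1 g1 where "f1 = normal_density (e \<bullet> x) \<sigma>" and "g1 = normal_density (e \<bullet> y) \<sigma>"
  have [measurable]: "f \<in> borel_measurable borel" "g \<in> borel_measurable borel"
    "f1 \<in> borel_measurable borel" "g1 \<in> borel_measurable borel"
    by (simp_all add: f_def g_def f1_def g1_def)
  have pos: "0 < f z" "0 < g z" "0 < f1 t" "0 < g1 t" for z t
    using s by (simp_all add: f_def g_def f1_def g1_def iso_density_pos normal_density_pos)
  have ratio: "f z * g1 (e \<bullet> z) = g z * f1 (e \<bullet> z)" for z
    unfolding f_def g_def f1_def g1_def
    by (rule iso_density_perp_eq[OF norm_e s]) (simp add: perp_xy)
  then have g_eq: "g z = f z * g1 (e \<bullet> z) / f1 (e \<bullet> z)" for z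
    using pos(3)[of "e \<bullet> z"] by (simp add: field_simps)
  interpret one: density_pair f1 g1
    unfolding f1_def g1_def using s xy1 by (rule density_pair_normal)
  \<comment> \<open>Substituting \<open>g = f g1 / f1\<close> carries the minimum and the positive
    parts from one dimension to the full space. The first two parts are recombined with
    \<open>f\<close>, the third with \<open>g\<close>, matching the draw whose orthogonal component
    the procedure attaches.\<close>
  have recombine:
    "(\<integral>\<^sup>+t. \<integral>\<^sup>+w. F (t *\<^sub>R e + perp e w) \<partial>density lborel f \<partial>one.overlap) = (\<integral>\<^sup>+z. F z \<partial>density lborel (\<lambda>z. ennreal (min (f z) (g z))))"
    "(\<integral>\<^sup>+t. \<integral>\<^sup>+w. F (t *\<^sub>R e + perp e w) \<partial>density lborel f \<partial>one.left_excess) = (\<integral>\<^sup>+z. F z \<partial>density lborel (\<lambda>z. ennreal (max 0 (f z - g z))))"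
    "(\<integral>\<^sup>+t. \<integral>\<^sup>+w. F (t *\<^sub>R e + perp e w) \<partial>density lborel g \<partial>one.right_excess) = (\<integral>\<^sup>+z. F z \<partial>density lborel (\<lambda>z. ennreal (max 0 (g z - f z))))"
    if [measurable]: "F \<in> borel_measurable borel" for F :: "real^'n \<Rightarrow> ennreal"
  proof -
    have "min (f1 (e \<bullet> z)) (g1 (e \<bullet> z)) / f1 (e \<bullet> z) * f z = min (f z) (g z)"
      "max 0 (f1 (e \<bullet> z) - g1 (e \<bullet> z)) / f1 (e \<bullet> z) * f z = max 0 (f z - g z)"
      "max 0 (g1 (e \<bullet> z) - f1 (e \<bullet> z)) / g1 (e \<bullet> z) * g z = max 0 (g z - f z)" for z
      using pos(1)[of z] pos(3,4)[of "e \<bullet> z"] unfolding g_eq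
      by (auto simp: min_def max_def field_simps)
    then show
      "(\<integral>\<^sup>+t. \<integral>\<^sup>+w. F (t *\<^sub>R e + perp e w) \<partial>density lborel f \<partial>one.overlap) = (\<integral>\<^sup>+z. F z \<partial>density lborel (\<lambda>z. ennreal (min (f z) (g z))))"
      "(\<integral>\<^sup>+t. \<integral>\<^sup>+w. F (t *\<^sub>R e + perp e w) \<partial>density lborel f \<partial>one.left_excess) = (\<integral>\<^sup>+z. F z \<partial>density lborel (\<lambda>z. ennreal (max 0 (f z - g z))))"
      "(\<integral>\<^sup>+t. \<integral>\<^sup>+w. F (t *\<^sub>R e + perp e w) \<partial>density lborel g \<partial>one.right_excess) = (\<integral>\<^sup>+z. F z \<partial>density lborel (\<lambda>z. ennreal (max 0 (g z - f z))))"
      using nn_integral_normal_recombine[OF norm_e s, of "\<lambda>t. min (f1 t) (g1 t)" F x]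
        nn_integral_normal_recombine[OF norm_e s, of "\<lambda>t. max 0 (f1 t - g1 t)" F x]
        nn_integral_normal_recombine[OF norm_e s, of "\<lambda>t. max 0 (g1 t - f1 t)" F y]
        pos(3,4)
      by (simp_all add: one.overlap_def one.left_excess_def one.right_excess_def f_def[symmetric] g_def[symmetric]
          f1_def[symmetric] g1_def[symmetric] less_imp_le)
  qed
  have int1: "(\<integral>\<^sup>+z. ennreal (f z) \<partial>lborel) = 1" "(\<integral>\<^sup>+z. ennreal (g z) \<partial>lborel) = 1"
    using nn_integral_iso_density[OF s] by (auto simp: f_def g_def)
  interpret F: prob_space "density lborel f"
    by standard (simp add: emeasure_density int1)
  interpret G: prob_space "density lborel g"
    by standard (simp add: emeasure_density int1)
  \<comment> \<open>Recombination preserves total mass, as the case \<open>F = 1\<close> shows.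
    Hence the excess mass does not depend on the dimension, and \<open>f\<close>, \<open>g\<close>
    cannot agree almost everywhere.\<close>
  have mass: "(\<integral>\<^sup>+z. ennreal (max 0 (f z - g z)) \<partial>lborel) = ennreal one.excess_mass"
    using recombine(2)[of "\<lambda>_. 1"] F.emeasure_space_1
    by (simp add: emeasure_density one.excess_mass_def one.left_excess.emeasure_eq_measure)
  interpret N: density_pair f g
  proof
    show "\<not> (AE z in lborel. f z = g z)"
    proof
      assume "AE z in lborel. f z = g z"
      then have "(\<integral>\<^sup>+z. ennreal (max 0 (f z - g z)) \<partial>lborel) = integral\<^sup>N lborel (\<lambda>z::real^'n. 0)"
        by (intro nn_integral_cong_AE) (auto elim: eventually_mono)
      with mass one.excess_mass_pos show False by simp
    qed
  qed (auto simp: pos less_imp_le int1)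
  have excess_mass_eq: "N.excess_mass = one.excess_mass"
    using mass one.excess_mass_pos by (simp add: N.excess_mass_def N.left_excess_def measure_def emeasure_density)

  let ?R = "rejection_law (e \<bullet> x) (e \<bullet> y) \<sigma>"
  have out: "max_indep_output e = (\<lambda>p.
      (fst (fst p) *\<^sub>R e + perp e (fst (snd p)),
       if fst (fst p) = snd (fst p) then snd (fst p) *\<^sub>R e + perp e (fst (snd p))
       else snd (fst p) *\<^sub>R e + perp e (snd (snd p))))"
    by (auto simp: max_indep_output_def outer_mult_vector Let_def fun_eq_iff)
  have sets_R[measurable_cong]: "sets ?R = sets (borel \<Otimes>\<^sub>M borel)"
    by (simp add: rejection_law_def)
  have law: "max_indep_law x y \<sigma> =
      distr (?R \<Otimes>\<^sub>M (density lborel f \<Otimes>\<^sub>M density lborel g)) (borel \<Otimes>\<^sub>M borel) (max_indep_output e)"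
    by (simp add: max_indep_law_def e_def[symmetric] Let_def mvn_eq_iso_density[OF s] f_def g_def)
  have out_measurable[measurable]:
    "max_indep_output e \<in> measurable (?R \<Otimes>\<^sub>M (density lborel f \<Otimes>\<^sub>M density lborel g)) (borel \<Otimes>\<^sub>M borel)"
    unfolding out by measurable
  interpret FG: pair_prob_space "density lborel f" "density lborel g" ..

  have "is_maximal_independent_coupling N.\<mu> N.\<nu> (max_indep_law x y \<sigma>)"
  proof (rule N.is_maximal_independent_couplingI)
    show "sets (max_indep_law x y \<sigma>) = sets (borel \<Otimes>\<^sub>M borel)"
      by (simp add: law)
    fix F :: "(real^'n) \<times> (real^'n) \<Rightarrow> ennreal"
    assume [measurable]: "F \<in> borel_measurable (borel \<Otimes>\<^sub>M borel)"
    \<comment> \<open>The conditional expectation of \<open>F\<close> given the one-dimensional pair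
      \<open>p\<close>, to which the formula for the rejection law is applied.\<close>
    define \<Phi> where "\<Phi> p = (\<integral>\<^sup>+w. \<integral>\<^sup>+v. F (max_indep_output e (p, (w, v))) \<partial>density lborel g \<partial>density lborel f)" for p
    have [measurable]: "\<Phi> \<in> borel_measurable (borel \<Otimes>\<^sub>M borel)"
      unfolding \<Phi>_def out by measurable
    define \<Psi> where "\<Psi> q = F (max_indep_output e q)" for q
    have [measurable]: "\<Psi> \<in> borel_measurable ((borel \<Otimes>\<^sub>M borel) \<Otimes>\<^sub>M (borel \<Otimes>\<^sub>M borel))"
      unfolding \<Psi>_def out by measurable
    have "(\<integral>\<^sup>+p. F p \<partial>max_indep_law x y \<sigma>) =
        (\<integral>\<^sup>+q. \<Psi> q \<partial>(?R \<Otimes>\<^sub>M (density lborel f \<Otimes>\<^sub>M density lborel g)))"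
      unfolding law \<Psi>_def by (rule nn_integral_distr) auto
    also have "\<dots> = (\<integral>\<^sup>+p. \<integral>\<^sup>+q. \<Psi> (p, q) \<partial>(density lborel f \<Otimes>\<^sub>M density lborel g) \<partial>?R)"
      by (rule FG.nn_integral_fst[symmetric]) measurable
    also have "\<dots> = (\<integral>\<^sup>+p. \<Phi> p \<partial>?R)"
    proof (intro nn_integral_cong)
      fix p :: "real \<times> real"
      have [measurable]: "(\<lambda>q. \<Psi> (p, q)) \<in> borel_measurable (borel \<Otimes>\<^sub>M borel)"
        by (rule measurable_compose[OF measurable_Pair1'[of p "borel \<Otimes>\<^sub>M borel"]]) (auto simp: space_pair_measure)
      show "(\<integral>\<^sup>+q. \<Psi> (p, q) \<partial>(density lborel f \<Otimes>\<^sub>M density lborel g)) = \<Phi> p"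
        unfolding \<Phi>_def \<Psi>_def[symmetric] by (rule G.nn_integral_fst[symmetric]) measurable
    qed
    also have "\<dots> = (\<integral>\<^sup>+z. \<Phi> (z, z) \<partial>one.overlap) + (\<integral>\<^sup>+t. \<integral>\<^sup>+u. \<Phi> (t, u) \<partial>one.right_excess \<partial>one.left_excess) / ennreal one.excess_mass"
      using nn_integral_rejection_law[OF s xy1, of \<Phi>] by (simp add: f1_def g1_def)
    \<comment> \<open>When the scalar outputs coincide, both points use the same orthogonal
      component, so the output lies on the diagonal and the second normal vector integrates to
      one.\<close>
    also have "(\<integral>\<^sup>+z. \<Phi> (z, z) \<partial>one.overlap) = (\<integral>\<^sup>+z. F (z, z) \<partial>N.overlap)"
      unfolding \<Phi>_def out N.overlap_def
      using recombine(1)[of "\<lambda>z. F (z, z)"] by (simp add: G.emeasure_space_1[simplified])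
    also have "(\<integral>\<^sup>+t. \<integral>\<^sup>+u. \<Phi> (t, u) \<partial>one.right_excess \<partial>one.left_excess) = (\<integral>\<^sup>+u. \<integral>\<^sup>+v. F (u, v) \<partial>N.right_excess \<partial>N.left_excess)"
    proof -
      \<comment> \<open>The two excesses live on the disjoint sets \<open>g1 < f1\<close> and
        \<open>f1 < g1\<close>, so there the scalar outputs differ and the independent second
        orthogonal component is used.\<close>
      have \<Phi>_off: "\<Phi> (t, u) = (\<integral>\<^sup>+w. \<integral>\<^sup>+v. F (t *\<^sub>R e + perp e w, u *\<^sub>R e + perp e v) \<partial>density lborel g \<partial>density lborel f)"
        if "g1 t < f1 t" "f1 u < g1 u" for t u
      proof -
        have "t \<noteq> u" using that by auto
        then show ?thesis by (simp add: \<Phi>_def out)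
      qed
      have "AE t in one.left_excess. g1 t < f1 t"
        unfolding one.left_excess_def by (subst AE_density) (auto simp: max_def)
      moreover have "AE u in one.right_excess. f1 u < g1 u"
        unfolding one.right_excess_def by (subst AE_density) (auto simp: max_def)
      then have "(\<integral>\<^sup>+u. \<Phi> (t, u) \<partial>one.right_excess) =
          (\<integral>\<^sup>+u. \<integral>\<^sup>+w. \<integral>\<^sup>+v. F (t *\<^sub>R e + perp e w, u *\<^sub>R e + perp e v) \<partial>density lborel g \<partial>density lborel f \<partial>one.right_excess)"
        if "g1 t < f1 t" for t
        using that by (intro nn_integral_cong_AE) (auto elim!: eventually_mono simp: \<Phi>_off)
      ultimately have "(\<integral>\<^sup>+t. \<integral>\<^sup>+u. \<Phi> (t, u) \<partial>one.right_excess \<partial>one.left_excess) =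
          (\<integral>\<^sup>+t. \<integral>\<^sup>+u. \<integral>\<^sup>+w. \<integral>\<^sup>+v. F (t *\<^sub>R e + perp e w, u *\<^sub>R e + perp e v) \<partial>density lborel g \<partial>density lborel f \<partial>one.right_excess \<partial>one.left_excess)"
        by (intro nn_integral_cong_AE) (auto elim: eventually_mono)
      \<comment> \<open>Swapping \<open>u\<close> and \<open>w\<close> puts each scalar next to its
        own orthogonal component, so that recombination applies first to the pair \<open>u\<close>,
        \<open>v\<close> and then to \<open>t\<close>, \<open>w\<close>.\<close>
      also have "\<dots> = (\<integral>\<^sup>+t. \<integral>\<^sup>+w. \<integral>\<^sup>+u. \<integral>\<^sup>+v. F (t *\<^sub>R e + perp e w, u *\<^sub>R e + perp e v) \<partial>density lborel g \<partial>one.right_excess \<partial>density lborel f \<partial>one.left_excess)"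
      proof -
        interpret P: pair_sigma_finite "density lborel f" one.right_excess ..
        show ?thesis by (intro nn_integral_cong P.Fubini') measurable
      qed
      also have "\<dots> = (\<integral>\<^sup>+t. \<integral>\<^sup>+w. \<integral>\<^sup>+v. F (t *\<^sub>R e + perp e w, v) \<partial>N.right_excess \<partial>density lborel f \<partial>one.left_excess)"
        unfolding N.right_excess_def by (intro nn_integral_cong recombine(3)) measurable
      also have "\<dots> = (\<integral>\<^sup>+u. \<integral>\<^sup>+v. F (u, v) \<partial>N.right_excess \<partial>N.left_excess)"
        unfolding N.left_excess_def by (rule recombine(2)) measurable
      finally show ?thesis .
    qed
    finally show "(\<integral>\<^sup>+p. F p \<partial>max_indep_law x y \<sigma>) =
        (\<integral>\<^sup>+z. F (z, z) \<partial>N.overlap) + (\<integral>\<^sup>+u. \<integral>\<^sup>+v. F (u, v) \<partial>N.right_excess \<partial>N.left_excess) / ennreal N.excess_mass"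
      by (simp add: excess_mass_eq)
  qed
  then show ?thesis
    unfolding N.\<mu>_def N.\<nu>_def mvn_eq_iso_density[OF s] unfolding f_def g_def .
qed

end
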